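(* Let $\alpha$ be a weakly Chaitin random real and let $V$ be an optimal computer. For every total recursive function $f\colon\mathbb{N}^+\to\mathbb{N}$, if there exists an oracle deterministic Turing machine $M$ such that, for all $n\in\mathbb{N}^+$, $M^{\mathrm{Dom}\,V\restriction n}(n)=\alpha\restriction(n-f(n))$, then $\sum_{n=1}^\infty 2^{-f(n)}<\infty$.
   Context: $\{0,1\}^*$ is the set of finite binary strings. A computer is a partial recursive function $C\colon\{0,1\}^*\to\{0,1\}^*$ whose domain $\mathrm{Dom}\,C$ is prefix-free. A computer $U$ is optimal if for every computer $C$ there is $d\in\mathbb{N}$ such that for every $p\in\mathrm{Dom}\,C$ there is $q$ with $U(q)=C(p)$ and $|q|\le|p|+d$. Fix an optimal computer $U$ and let $H(s)=\min\{|p|: U(p)=s\}$ (program-size complexity). A real $\alpha$ is weakly Chaitin random if there is $c\in\mathbb{N}$ with $n-c\le H(\alpha\restriction n)$ for all $n\in\mathbb{N}^+$. For $S\subseteq\{0,1\}^*$ and $n\in\mathbb{Z}$, $S\restriction n=\{s\in S:|s|\le n\}$. For a real $\alpha$ and $n\in\mathbb{N}^+$, $\alpha\restriction n$ is the string of the first $n$ bits of the base-two expansion of $\alpha-\lfloor\alpha\rfloor$ (with infinitely many zeros when there is a choice); for integers $n\le0$ it is the empty string. $M^A(n)$ is the output of oracle machine $M$ on input $n$ with oracle set $A$. *)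

theory Defs
  imports Complex_Main "HOL-Library.Sublist"
begin

section \<open>Partial recursive functions\<close>

text \<open>Kleene's schemes. Arities are not tracked: a term applied to an argument list of
  unsuitable length is undefined there.\<close>

datatype recf =
    Zero
  | Succ
  | Proj nat
  | Comp recf "recf list"
  | PrimRec recf recf
  | Mu recf

fun rec_eval :: "recf \<Rightarrow> nat list \<Rightarrow> nat option" where
  "rec_eval Zero xs = Some 0"
| "rec_eval Succ xs = (case xs of [x] \<Rightarrow> Some (Suc x) | _ \<Rightarrow> None)"
| "rec_eval (Proj i) xs = (if i < length xs then Some (xs ! i) else None)"
| "rec_eval (Comp f gs) xs = Option.bind (those (map (\<lambda>g. rec_eval g xs) gs)) (rec_eval f)"
| "rec_eval (PrimRec f g) xs =
     (case xs of
        [] \<Rightarrow> None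
      | n # ys \<Rightarrow> rec_nat (rec_eval f ys)
                   (\<lambda>k r. Option.bind r (\<lambda>y. rec_eval g (k # y # ys))) n)"
| "rec_eval (Mu f) xs =
     (if \<exists>n. rec_eval f (n # xs) = Some 0 \<and> (\<forall>k<n. rec_eval f (k # xs) \<noteq> None)
      then Some (LEAST n. rec_eval f (n # xs) = Some 0)
      else None)"

definition partial_recursive :: "(nat \<Rightarrow> nat option) \<Rightarrow> bool" where
  "partial_recursive F \<longleftrightarrow> (\<exists>r. \<forall>x. rec_eval r [x] = F x)"

text \<open>A function defined on the positive integers is a function on \<open>nat\<close> whose value at 0 is
  irrelevant.\<close>

definition total_recursive_pos :: "(nat \<Rightarrow> nat) \<Rightarrow> bool" where
  "total_recursive_pos f \<longleftrightarrow> partial_recursive (\<lambda>n. if 1 \<le> n then Some (f n) else None)"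

text \<open>Strings are coded by numbers through the bijective base-two numeration, with the first bit
  least significant.\<close>

fun str_code :: "bool list \<Rightarrow> nat" where
  "str_code [] = 0"
| "str_code (b # s) = 2 * str_code s + (if b then 2 else 1)"

lemma bij_str_code: "bij str_code"
proof (rule bijI)
  have "str_code s = str_code t \<Longrightarrow> s = t" for s t
  proof (induction s arbitrary: t)
    case Nil
    then show ?case by (cases t) (auto split: if_splits)
  next
    case (Cons b s)
    then obtain c t' where t: "t = c # t'" by (cases t) (auto split: if_splits)
    have "b = c \<and> str_code s = str_code t'"
      using Cons.prems unfolding t by (cases b; cases c; simp; presburger)
    then show ?case using Cons.IH t by blast
  qed
  then show "inj str_code" by (rule injI)
  have "\<exists>s. str_code s = n" for n
  proof (induction n rule: less_induct)
    case (less n)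
    show ?case
    proof (cases "n = 0")
      case True
      then have "str_code [] = n" by simp
      then show ?thesis ..
    next
      case False
      then have "(n - 1) div 2 < n" by simp
      from less[OF this] obtain s where s: "str_code s = (n - 1) div 2" ..
      have "str_code (even n # s) = n" using s False by (cases "even n"; simp; presburger)
      then show ?thesis ..
    qed
  qed
  then show "surj str_code" by (metis surjI)
qed

definition partial_recursive_str :: "(bool list \<Rightarrow> bool list option) \<Rightarrow> bool" where
  "partial_recursive_str C \<longleftrightarrow> (\<exists>r. \<forall>s. rec_eval r [str_code s] = map_option str_code (C s))"


section \<open>Computers and program-size complexity\<close>

definition prefix_free :: "bool list set \<Rightarrow> bool" where
  "prefix_free S \<longleftrightarrow> (\<forall>s\<in>S. \<forall>t\<in>S. prefix s t \<longrightarrow> s = t)"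

definition computer :: "(bool list \<Rightarrow> bool list option) \<Rightarrow> bool" where
  "computer C \<longleftrightarrow> partial_recursive_str C \<and> prefix_free (dom C)"

definition optimal_computer :: "(bool list \<Rightarrow> bool list option) \<Rightarrow> bool" where
  "optimal_computer U \<longleftrightarrow> computer U \<and>
     (\<forall>C. computer C \<longrightarrow>
        (\<exists>d::nat. \<forall>p\<in>dom C. \<exists>q\<in>dom U. U q = C p \<and> length q \<le> length p + d))"

definition complexity :: "(bool list \<Rightarrow> bool list option) \<Rightarrow> bool list \<Rightarrow> nat" where
  "complexity U s = Inf {length p | p. U p = Some s}"


section \<open>Binary expansions and restrictions\<close>

text \<open>The index \<open>i\<close> starts at 0, so \<open>b i\<close> is the bit of weight \<open>2\<^sup>-\<^sup>(\<^sup>i\<^sup>+\<^sup>1\<^sup>)\<close>.\<close>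

definition is_binary_expansion :: "(nat \<Rightarrow> bool) \<Rightarrow> real \<Rightarrow> bool" where
  "is_binary_expansion b x \<longleftrightarrow>
     (\<lambda>i. of_bool (b i) / 2 ^ Suc i) sums x \<and> infinite {i. \<not> b i}"

definition binary_expansion :: "real \<Rightarrow> nat \<Rightarrow> bool" where
  "binary_expansion \<alpha> = (THE b. is_binary_expansion b (\<alpha> - of_int \<lfloor>\<alpha>\<rfloor>))"

lemma is_binary_expansion_unique:
  assumes "is_binary_expansion b x"
  shows "b n \<longleftrightarrow> odd \<lfloor>2 ^ Suc n * x\<rfloor>"
proof -
  let ?t = "\<lambda>i. of_bool (b i) / 2 ^ Suc i :: real"
  define K :: "nat \<Rightarrow> int" where "K = rec_nat 0 (\<lambda>i k. 2 * k + of_bool (b i))"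
  have KS: "K 0 = 0" "K (Suc i) = 2 * K i + of_bool (b i)" for i by (simp_all add: K_def)
  have sums: "?t sums x" and inf: "infinite {i. \<not> b i}"
    using assms by (auto simp: is_binary_expansion_def)
  have K: "of_int (K n) = 2 ^ n * (\<Sum>i<n. ?t i)" for n
    by (induction n) (simp_all add: KS field_simps)
  have floor: "\<lfloor>2 ^ n * x\<rfloor> = K n" for n
  proof -
    have tail: "(\<lambda>i. ?t (i + n)) sums (x - (\<Sum>i<n. ?t i))"
      using sums_split_initial_segment[OF sums] .
    have geo: "(\<lambda>i. (1 / 2 ^ Suc n) * (1 / 2) ^ i :: real) sums ((1 / 2 ^ Suc n) * 2)"
      using sums_mult[OF geometric_sums[of "1/2 :: real"], of "1 / 2 ^ Suc n"] by simp
    have le: "?t (i + n) \<le> (1 / 2 ^ Suc n) * (1 / 2) ^ i" for i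
      by (simp add: power_add field_simps)
    obtain m where m: "m \<ge> n" "\<not> b m"
      using inf by (auto simp: finite_nat_set_iff_bounded not_less)
    have lo: "0 \<le> x - (\<Sum>i<n. ?t i)"
      using sums_le[OF _ sums_zero tail] by simp
    have "0 < (\<Sum>i. (1 / 2 ^ Suc n) * (1 / 2) ^ i - ?t (i + n))"
    proof (rule suminf_pos2[where i = "m - n"])
      show "summable (\<lambda>i. (1 / 2 ^ Suc n) * (1 / 2) ^ i - ?t (i + n))"
        using sums_diff[OF geo tail] by (rule sums_summable)
      show "0 \<le> (1 / 2 ^ Suc n) * (1 / 2) ^ i - ?t (i + n)" for i using le[of i] by linarith
      show "0 < (1 / 2 ^ Suc n) * (1 / 2) ^ (m - n) - ?t (m - n + n)" using m by simp
    qed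
    also have "\<dots> = (1 / 2 ^ Suc n) * 2 - (x - (\<Sum>i<n. ?t i))"
      using sums_diff[OF geo tail] by (rule sums_unique[symmetric])
    finally have "x - (\<Sum>i<n. ?t i) < 1 / 2 ^ n" by simp
    then have "2 ^ n * (x - (\<Sum>i<n. ?t i)) < 1" by (simp add: field_simps)
    moreover have "0 \<le> 2 ^ n * (x - (\<Sum>i<n. ?t i))" using lo by simp
    ultimately show ?thesis using K[of n] by (simp add: floor_eq_iff right_diff_distrib)
  qed
  show ?thesis unfolding floor KS by simp
qed

lemma is_binary_expansion_exists:
  assumes x: "0 \<le> x" "x < 1"
  shows "is_binary_expansion (\<lambda>n. odd \<lfloor>2 ^ Suc n * x\<rfloor>) x"
proof -
  define b where "b = (\<lambda>n. odd \<lfloor>2 ^ Suc n * x\<rfloor>)"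
  let ?t = "\<lambda>i. of_bool (b i) / 2 ^ Suc i :: real"
  have step: "\<lfloor>2 ^ Suc n * x\<rfloor> = 2 * \<lfloor>2 ^ n * x\<rfloor> + of_bool (b n)" for n
  proof -
    have "\<lfloor>2 ^ Suc n * x\<rfloor> = 2 * \<lfloor>2 ^ n * x\<rfloor> \<or> \<lfloor>2 ^ Suc n * x\<rfloor> = 2 * \<lfloor>2 ^ n * x\<rfloor> + 1"
      by (simp add: floor_eq_iff) linarith
    then show ?thesis unfolding b_def by auto
  qed
  have part: "(\<Sum>i<n. ?t i) = of_int \<lfloor>2 ^ n * x\<rfloor> / 2 ^ n" for n
  proof (induction n)
    case 0
    have "\<lfloor>x\<rfloor> = 0" using x by (simp add: floor_eq_iff)
    then show ?case by simp
  next
    case (Suc n)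
    then show ?case unfolding step by (simp add: field_simps)
  qed
  have bound: "x - 1 / 2 ^ n \<le> (\<Sum>i<n. ?t i) \<and> (\<Sum>i<n. ?t i) \<le> x" for n
  proof -
    have "2 ^ n * x - 1 \<le> of_int \<lfloor>2 ^ n * x\<rfloor>" "of_int \<lfloor>2 ^ n * x\<rfloor> \<le> 2 ^ n * x" by linarith+
    then have "(2 ^ n * x - 1) / 2 ^ n \<le> of_int \<lfloor>2 ^ n * x\<rfloor> / 2 ^ n"
      "of_int \<lfloor>2 ^ n * x\<rfloor> / 2 ^ n \<le> 2 ^ n * x / 2 ^ n"
      by (meson divide_right_mono zero_le_power zero_le_numeral)+
    then show ?thesis unfolding part by (simp add: diff_divide_distrib)
  qed
  have "(\<lambda>n. x - (1 / 2) ^ n) \<longlonglongrightarrow> x - 0"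
    by (intro tendsto_diff tendsto_const LIMSEQ_power_zero) simp
  then have "(\<lambda>n. x - 1 / 2 ^ n) \<longlonglongrightarrow> x" by (simp add: power_one_over)
  from tendsto_sandwich[OF _ _ this tendsto_const, of "\<lambda>n. \<Sum>i<n. ?t i"]
  have sums: "?t sums x"
    using bound unfolding sums_def by (simp only: eventually_True simp_thms)
  have "infinite {i. \<not> b i}"
  proof
    assume "finite {i. \<not> b i}"
    then obtain N where N: "b i" if "i \<ge> N" for i
      by (auto simp: finite_nat_set_iff_bounded) (meson not_less)
    have "(\<lambda>i. ?t (i + N)) sums (x - (\<Sum>i<N. ?t i))"
      using sums_split_initial_segment[OF sums] .
    moreover have "?t (i + N) = (1 / 2 ^ Suc N) * (1 / 2) ^ i" for i
      using N[of "i + N"] by (simp add: power_add field_simps)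
    moreover have "(\<lambda>i. (1 / 2 ^ Suc N) * (1 / 2) ^ i :: real) sums ((1 / 2 ^ Suc N) * 2)"
      using sums_mult[OF geometric_sums[of "1/2 :: real"], of "1 / 2 ^ Suc N"] by simp
    ultimately have "x - (\<Sum>i<N. ?t i) = (1 / 2 ^ Suc N) * 2" by (metis (no_types, lifting) sums_cong sums_unique2)
    then have "2 ^ N * x = of_int (\<lfloor>2 ^ N * x\<rfloor> + 1)" unfolding part by (simp add: field_simps)
    then show False by linarith
  qed
  with sums show ?thesis by (simp add: is_binary_expansion_def b_def)
qed

lemma binary_expansion_ex1: "\<exists>!b. is_binary_expansion b (\<alpha> - of_int \<lfloor>\<alpha>\<rfloor>)"
proof (rule ex_ex1I)
  have "0 \<le> \<alpha> - of_int \<lfloor>\<alpha>\<rfloor>" "\<alpha> - of_int \<lfloor>\<alpha>\<rfloor> < 1" by linarith+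
  then show "\<exists>b. is_binary_expansion b (\<alpha> - of_int \<lfloor>\<alpha>\<rfloor>)"
    using is_binary_expansion_exists by blast
qed (use is_binary_expansion_unique in blast)

definition real_restrict :: "real \<Rightarrow> int \<Rightarrow> bool list" where
  "real_restrict \<alpha> n = map (binary_expansion \<alpha>) [0..<nat n]"

definition set_restrict :: "bool list set \<Rightarrow> int \<Rightarrow> bool list set" where
  "set_restrict S n = {s \<in> S. int (length s) \<le> n}"

definition weakly_Chaitin_random :: "(bool list \<Rightarrow> bool list option) \<Rightarrow> real \<Rightarrow> bool" where
  "weakly_Chaitin_random U \<alpha> \<longleftrightarrow>
     (\<exists>c::nat. \<forall>n::nat. 1 \<le> n \<longrightarrow>
        int n - int c \<le> int (complexity U (real_restrict \<alpha> (int n))))"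


section \<open>Oracle deterministic Turing machines\<close>

text \<open>A machine has a work tape and an oracle tape, both two-way infinite and read-write. The
  transition table is a finite partial function; the machine halts when no transition applies.
  On entering the query state it asks whether the string on the oracle tape belongs to the oracle
  set and moves to the yes or no state accordingly, leaving both tapes unchanged.\<close>

datatype tape_symbol = Blank | Bit bool | Aux nat

datatype direction = Move_Left | Stay | Move_Right

record oracle_tm =
  start_state :: nat
  query_state :: nat
  yes_state :: nat
  no_state :: nat
  transition :: "nat \<times> tape_symbol \<times> tape_symbol \<Rightarrow>
    (nat \<times> (tape_symbol \<times> direction) \<times> (tape_symbol \<times> direction)) option"

definition is_oracle_tm :: "oracle_tm \<Rightarrow> bool" where
  "is_oracle_tm M \<longleftrightarrow> finite (dom (transition M))"

text \<open>In a tape \<open>(l, r)\<close>, \<open>r\<close> lists the cells from the head rightwards and \<open>l\<close> the cells left of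
  the head, nearest first; all cells not listed are blank.\<close>

type_synonym tape = "tape_symbol list \<times> tape_symbol list"

fun cell :: "tape_symbol list \<Rightarrow> tape_symbol" where
  "cell [] = Blank"
| "cell (a # _) = a"

definition tape_read :: "tape \<Rightarrow> tape_symbol" where
  "tape_read t = cell (snd t)"

fun tape_write :: "tape_symbol \<Rightarrow> tape \<Rightarrow> tape" where
  "tape_write a (l, r) = (l, a # tl r)"

fun tape_move :: "direction \<Rightarrow> tape \<Rightarrow> tape" where
  "tape_move Move_Left (l, r) = (tl l, cell l # r)"
| "tape_move Stay (l, r) = (l, r)"
| "tape_move Move_Right (l, r) = (cell r # l, tl r)"

text \<open>The string on a tape is read from the head rightwards up to the first cell not holding a
  bit.\<close>

fun leading_bits :: "tape_symbol list \<Rightarrow> bool list" where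
  "leading_bits (Bit b # r) = b # leading_bits r"
| "leading_bits _ = []"

definition tape_string :: "tape \<Rightarrow> bool list" where
  "tape_string t = leading_bits (snd t)"

type_synonym config = "nat \<times> tape \<times> tape"

fun otm_step :: "oracle_tm \<Rightarrow> bool list set \<Rightarrow> config \<Rightarrow> config option" where
  "otm_step M A (q, w, t) =
     (if q = query_state M
      then Some (if tape_string t \<in> A then yes_state M else no_state M, w, t)
      else case transition M (q, tape_read w, tape_read t) of
             None \<Rightarrow> None
           | Some (q', (a, d), (b, e)) \<Rightarrow>
               Some (q', tape_move d (tape_write a w), tape_move e (tape_write b t)))"

text \<open>The input \<open>n\<close> is presented in unary.\<close>

definition otm_init :: "oracle_tm \<Rightarrow> nat \<Rightarrow> config" where
  "otm_init M n = (start_state M, ([], replicate n (Bit True)), ([], []))"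

definition otm_outputs :: "oracle_tm \<Rightarrow> bool list set \<Rightarrow> nat \<Rightarrow> bool list \<Rightarrow> bool" where
  "otm_outputs M A n s \<longleftrightarrow>
     (\<exists>q w t. (\<lambda>c c'. otm_step M A c = Some c')\<^sup>*\<^sup>* (otm_init M n) (q, w, t) \<and>
        otm_step M A (q, w, t) = None \<and> tape_string w = s)"

end

(*
  Let n be positive and A(n,t) the stage-t approximation of Dom V restricted to length n. Running M
  on n with oracle A(n,t) yields at most |Dom V restricted to n| + 1 different strings, since the
  sets A(n,t) form a chain in t, and one of them is a prefix of alpha of length n - f(n).
  Give each real x the weight F(x), the sum of 2^-f(n) over those n for which x begins with a
  candidate of length n - f(n). The integral of F is at most
  the sum over n of (|Dom V restricted to n| + 1) 2^-n, which is at most 3 by Kraft's inequality,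
  whereas F(alpha) is infinite if the sum of 2^-f(n) diverges. So F is an integral test for
  randomness that alpha fails: the c.e. open sets {F > 2^(k+2)} have measure at most 2^-k, all
  contain alpha, and a Kraft-Chaitin coding of them compresses prefixes of alpha by
  arbitrarily many bits.
*)

theory Submission
  imports Defs "HOL-Library.Nat_Bijection"
begin

section \<open>Computable functions between coded types\<close>

text \<open>\<open>Dom V\<close> is only c.e., so no stage is known to be final, and on an
  unfinished oracle \<open>M\<close> may diverge or print a wrong string. A candidate therefore
  cannot be verified; candidates can only be counted. The weight \<open>2^-f(n)\<close> is chosen to
  fit that count: a candidate of length \<open>n - f(n)\<close> has measure
  \<open>2^-(n - f(n))\<close>, so each one contributes exactly \<open>2^-n\<close>. The bound 3
  splits as 2 + 1. A word \<open>p\<close> of \<open>Dom V\<close> is counted for every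
  \<open>n\<close> from \<open>|p|\<close> on, at a total cost of at most \<open>2 * 2^-|p|\<close>,
  and Kraft bounds the sum by 2; the extra candidate for each \<open>n\<close> costs
  \<open>2^-n\<close>, in all at most 1. Stage \<open>t\<close> treats only strings of length
  \<open>t\<close> and scales everything by \<open>2^t\<close>, so the test is arithmetic of natural
  numbers and decidable at each stage. Since strings are requested in order of length, the
  Kraft-Chaitin allocation is explicit: the programs used at one stage lie in an interval of values
  computed from two counts. A program's length reveals its stage, so the coding machine is a total
  computable function into \<open>option\<close>.\<close>

class coded =
  fixes enc :: "'a \<Rightarrow> nat"
  assumes enc_eq_iff [simp]: "enc x = enc y \<longleftrightarrow> x = y"

instantiation nat :: coded
begin
definition enc_nat :: "nat \<Rightarrow> nat" where [simp]: "enc_nat n = n"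
instance by standard simp
end

instantiation bool :: coded
begin
definition enc_bool :: "bool \<Rightarrow> nat" where [simp]: "enc_bool b = of_bool b"
instance by standard simp
end

instantiation prod :: (coded, coded) coded
begin
definition enc_prod :: "'a \<times> 'b \<Rightarrow> nat" where
  [simp]: "enc_prod p = prod_encode (enc (fst p), enc (snd p))"
instance by standard (simp add: prod_eq_iff)
end

instantiation option :: (coded) coded
begin
definition enc_option :: "'a option \<Rightarrow> nat" where
  "enc_option z = (case z of None \<Rightarrow> 0 | Some x \<Rightarrow> Suc (enc x))"
instance by standard (auto simp: enc_option_def split: option.splits)
end

instantiation list :: (coded) coded
begin
primrec enc_list :: "'a list \<Rightarrow> nat" where
  "enc_list [] = 0"
| "enc_list (x # xs) = Suc (prod_encode (enc x, enc_list xs))"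
instance
proof
  show "enc xs = enc ys \<longleftrightarrow> xs = ys" for xs ys :: "'a list"
  proof (induction xs arbitrary: ys)
    case Nil
    then show ?case by (cases ys) auto
  next
    case (Cons x xs)
    then show ?case by (cases ys) auto
  qed
qed
end

lemma enc_simps [simp]:
  "enc None = 0" "enc (Some x) = Suc (enc x)"
  "enc [] = 0" "enc (x # xs) = Suc (prod_encode (enc x, enc xs))"
  by (simp_all add: enc_option_def)

instantiation tape_symbol :: coded
begin
definition enc_tape_symbol :: "tape_symbol \<Rightarrow> nat" where
  "enc_tape_symbol a = (case a of Blank \<Rightarrow> 0 | Bit b \<Rightarrow> Suc (of_bool b) | Aux n \<Rightarrow> n + 3)"
instance by standard (auto simp: enc_tape_symbol_def split: tape_symbol.splits)
end

instantiation direction :: coded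
begin
definition enc_direction :: "direction \<Rightarrow> nat" where
  "enc_direction d = (case d of Move_Left \<Rightarrow> 0 | Stay \<Rightarrow> 1 | Move_Right \<Rightarrow> 2)"
instance by standard (auto simp: enc_direction_def split: direction.splits)
end

text \<open>Only the values on codes matter, so injective codes suffice and non-codes never have to
  be recognized. Partial maps appear as total ones with \<open>option\<close> values, hence with
  decidable domain.\<close>

definition computable :: "('a::coded \<Rightarrow> 'b::coded) \<Rightarrow> bool" where
  "computable f \<longleftrightarrow> (\<exists>r. \<forall>x. rec_eval r [enc x] = Some (enc (f x)))"

named_theorems computable_intros

section \<open>Terms for arithmetic and for Cantor pairing with its projections\<close>

definition add_rf :: recf where "add_rf = PrimRec (Proj 0) (Comp Succ [Proj 1])"
definition pred_rf :: recf where "pred_rf = PrimRec Zero (Proj 0)"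
definition sub_rf :: recf where "sub_rf = PrimRec (Proj 0) (Comp pred_rf [Proj 1])"
definition tri_rf :: recf where
  "tri_rf = PrimRec Zero (Comp add_rf [Proj 1, Comp Succ [Proj 0]])"
definition pair_rf :: recf where "pair_rf = Comp add_rf [Comp tri_rf [add_rf], Proj 0]"
text \<open>For \<open>z = triangle (m + n) + m\<close>, the least \<open>s\<close> with
  \<open>z < triangle (Suc s)\<close> is \<open>m + n\<close>. \<open>Mu\<close> searches for zeros,
  so the strict inequality is written \<open>Suc z - triangle (Suc s) = 0\<close>.\<close>

definition root_rf :: recf where
  "root_rf = Mu (Comp sub_rf [Comp tri_rf [Comp Succ [Proj 0]], Comp Succ [Proj 1]])"
definition fst_rf :: recf where "fst_rf = Comp sub_rf [Comp tri_rf [root_rf], Proj 0]"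
definition snd_rf :: recf where "snd_rf = Comp sub_rf [fst_rf, root_rf]"

lemma rec_eval_add: "rec_eval add_rf [m, n] = Some (m + n)"
  by (induction m) (simp_all add: add_rf_def)

lemma rec_eval_pred: "rec_eval pred_rf [n] = Some (n - 1)"
  by (induction n) (simp_all add: pred_rf_def)

text \<open>\<open>PrimRec\<close> recurses on its first argument, so the subtrahend comes
  first.\<close>

lemma rec_eval_sub: "rec_eval sub_rf [m, n] = Some (n - m)"
  by (induction m) (simp_all add: sub_rf_def rec_eval_pred)

lemma rec_eval_tri: "rec_eval tri_rf [n] = Some (triangle n)"
  by (induction n) (simp_all add: tri_rf_def rec_eval_add)

lemma rec_eval_pair: "rec_eval pair_rf [m, n] = Some (prod_encode (m, n))"
  by (simp add: pair_rf_def rec_eval_add rec_eval_tri prod_encode_def)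

lemma triangle_mono: "m \<le> n \<Longrightarrow> triangle m \<le> triangle n"
  by (induction n rule: dec_induct) simp_all

lemma rec_eval_root: "rec_eval root_rf [prod_encode (m, n)] = Some (m + n)"
proof -
  let ?z = "prod_encode (m, n)"
  have iff: "Suc ?z - triangle (Suc s) = 0 \<longleftrightarrow> m + n \<le> s" for s
  proof
    assume "Suc ?z - triangle (Suc s) = 0"
    then have "triangle (m + n) < triangle (Suc s)" by (simp add: prod_encode_def)
    then show "m + n \<le> s" using triangle_mono[of "Suc s" "m + n"] by linarith
  next
    assume "m + n \<le> s"
    then have "triangle (Suc (m + n)) \<le> triangle (Suc s)" by (intro triangle_mono) simp
    then show "Suc ?z - triangle (Suc s) = 0" by (simp add: prod_encode_def)
  qed
  have ev: "rec_eval (Comp sub_rf [Comp tri_rf [Comp Succ [Proj 0]], Comp Succ [Proj 1]]) [s, ?z]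
      = Some (Suc ?z - triangle (Suc s))" for s
    by (simp add: rec_eval_sub rec_eval_tri)
  have "(LEAST s. m + n \<le> s) = m + n" by (rule Least_equality) auto
  then show ?thesis
    unfolding root_rf_def rec_eval.simps(6) ev option.inject iff by auto
qed

lemma rec_eval_fst: "rec_eval fst_rf [prod_encode (m, n)] = Some m"
  by (simp add: fst_rf_def rec_eval_root rec_eval_tri rec_eval_sub) (simp add: prod_encode_def)

lemma rec_eval_snd: "rec_eval snd_rf [prod_encode (m, n)] = Some n"
  by (simp add: snd_rf_def rec_eval_root rec_eval_fst rec_eval_sub)

lemma rec_eval_const: "\<exists>r. \<forall>xs. rec_eval r xs = Some n"
proof (induction n)
  case 0
  have "\<forall>xs. rec_eval Zero xs = Some 0" by simp
  then show ?case ..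
next
  case (Suc n)
  then obtain r where "\<forall>xs. rec_eval r xs = Some n" ..
  then have "\<forall>xs. rec_eval (Comp Succ [r]) xs = Some (Suc n)" by simp
  then show ?case ..
qed

text \<open>\<open>Comp\<close> is strict, so a branch that must not be evaluated is put into the step of a
  primitive recursion that is executed zero times.\<close>

definition if_rf :: "recf \<Rightarrow> recf \<Rightarrow> recf \<Rightarrow> recf" where
  "if_rf c r s = Comp add_rf
     [Comp (PrimRec Zero (Comp r [Proj 2])) [c, Proj 0],
      Comp (PrimRec Zero (Comp s [Proj 2])) [Comp sub_rf [c, Comp Succ [Zero]], Proj 0]]"

text \<open>Only the test has to be defined. The equation covers undefined branches too, which later
  turns a \<open>None\<close> value into divergence.\<close>

lemma rec_eval_if:
  assumes "rec_eval c [x] = Some (of_bool b)"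
  shows "rec_eval (if_rf c r s) [x] = (if b then rec_eval r [x] else rec_eval s [x])"
  using assms by (cases "rec_eval r [x]"; cases "rec_eval s [x]"; cases b)
    (simp_all add: if_rf_def rec_eval_sub rec_eval_add)

section \<open>Closure under composition, pairing, recursion and case distinction\<close>

lemma computable_id [computable_intros]: "computable (\<lambda>x. x)"
proof -
  have "\<forall>x :: 'a. rec_eval (Proj 0) [enc x] = Some (enc x)" by simp
  then show ?thesis unfolding computable_def ..
qed

lemma computable_const [computable_intros]: "computable (\<lambda>x. c)"
  using rec_eval_const[of "enc c"] by (auto simp: computable_def)

lemma computable_compose:
  assumes "computable f" "computable g"
  shows "computable (\<lambda>x. f (g x))"
proof -
  obtain r s where "\<forall>x. rec_eval r [enc x] = Some (enc (f x))"
    "\<forall>x. rec_eval s [enc x] = Some (enc (g x))"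
    using assms by (auto simp: computable_def)
  then have "\<forall>x. rec_eval (Comp r [s]) [enc x] = Some (enc (f (g x)))" by simp
  then show ?thesis unfolding computable_def ..
qed

lemma computable_Pair [computable_intros]:
  assumes "computable f" "computable g"
  shows "computable (\<lambda>x. (f x, g x))"
proof -
  obtain r s where "\<forall>x. rec_eval r [enc x] = Some (enc (f x))"
    "\<forall>x. rec_eval s [enc x] = Some (enc (g x))"
    using assms by (auto simp: computable_def)
  then have "\<forall>x. rec_eval (Comp pair_rf [r, s]) [enc x] = Some (enc (f x, g x))"
    by (simp add: rec_eval_pair)
  then show ?thesis unfolding computable_def ..
qed

lemma computable_fst [computable_intros]:
  fixes f :: "'x::coded \<Rightarrow> 'a::coded \<times> 'b::coded"
  assumes "computable f"
  shows "computable (\<lambda>x. fst (f x))"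
proof (rule computable_compose[OF _ assms])
  have "\<forall>p :: 'a \<times> 'b. rec_eval fst_rf [enc p] = Some (enc (fst p))" by (simp add: rec_eval_fst)
  then show "computable (fst :: 'a \<times> 'b \<Rightarrow> 'a)" unfolding computable_def ..
qed

lemma computable_snd [computable_intros]:
  fixes f :: "'x::coded \<Rightarrow> 'a::coded \<times> 'b::coded"
  assumes "computable f"
  shows "computable (\<lambda>x. snd (f x))"
proof (rule computable_compose[OF _ assms])
  have "\<forall>p :: 'a \<times> 'b. rec_eval snd_rf [enc p] = Some (enc (snd p))" by (simp add: rec_eval_snd)
  then show "computable (snd :: 'a \<times> 'b \<Rightarrow> 'b)" unfolding computable_def ..
qed

text \<open>Bodies with a bound variable are stated uncurried, the context paired with that
  variable; this rule feeds them arbitrary computable arguments.\<close>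

lemma computable_compose2:
  assumes "computable (\<lambda>z. h (fst z) (snd z))" "computable f" "computable g"
  shows "computable (\<lambda>x. h (f x) (g x))"
  using computable_compose[OF assms(1) computable_Pair[OF assms(2,3)]] by simp

lemma computable_if [computable_intros]:
  assumes "computable P" "computable f" "computable g"
  shows "computable (\<lambda>x. if P x then f x else g x)"
proof -
  obtain c r s where c: "\<forall>x. rec_eval c [enc x] = Some (enc (P x))"
    and r: "\<forall>x. rec_eval r [enc x] = Some (enc (f x))"
    and s: "\<forall>x. rec_eval s [enc x] = Some (enc (g x))"
    using assms by (auto simp: computable_def)
  have "\<forall>x. rec_eval (if_rf c r s) [enc x] = Some (enc (if P x then f x else g x))"
    using c r s by (simp add: rec_eval_if)
  then show ?thesis unfolding computable_def ..
qed

lemma computable_rec_nat [computable_intros]: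
  assumes "computable a" "computable (\<lambda>z. b (fst z) (fst (snd z)) (snd (snd z)))" "computable n"
  shows "computable (\<lambda>x. rec_nat (a x) (\<lambda>i y. b x i y) (n x))"
proof -
  obtain ra rb rn where ra: "\<forall>x. rec_eval ra [enc x] = Some (enc (a x))"
    and rb: "\<forall>z. rec_eval rb [enc z] = Some (enc (b (fst z) (fst (snd z)) (snd (snd z))))"
    and rn: "\<forall>x. rec_eval rn [enc x] = Some (n x)"
    using assms by (auto simp: computable_def)
  \<comment> \<open>\<open>PrimRec\<close> supplies counter, previous value and parameter; they are
    repacked as the code of \<open>(x, i, y)\<close>.\<close>
  define s where "s = Comp rb [Comp pair_rf [Proj 2, Comp pair_rf [Proj 0, Proj 1]]]"
  have step: "rec_eval s [i, enc y, enc x] = Some (enc (b x i y))" for i x y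
    using rb[rule_format, of "(x, i, y)"] by (simp add: s_def rec_eval_pair)
  have rec: "rec_eval (PrimRec ra s) [k, enc x] = Some (enc (rec_nat (a x) (\<lambda>i y. b x i y) k))" for k x
  proof (induction k)
    case (Suc k)
    have "rec_eval (PrimRec ra s) [Suc k, enc x]
        = Option.bind (rec_eval (PrimRec ra s) [k, enc x]) (\<lambda>y. rec_eval s [k, y, enc x])"
      by (simp only: rec_eval.simps list.case old.nat.simps)
    then show ?case unfolding Suc by (simp only: bind.simps step old.nat.simps)
  qed (simp add: ra)
  have "\<forall>x. rec_eval (Comp (PrimRec ra s) [rn, Proj 0]) [enc x]
      = Some (enc (rec_nat (a x) (\<lambda>i y. b x i y) (n x)))"
    using rn by (simp add: rec del: rec_eval.simps(5))
  then show ?thesis unfolding computable_def ..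
qed

text \<open>Case distinction for the types whose codes are 0 or the successor of the code of the
  constructor arguments.\<close>

lemma computable_payload:
  assumes "computable l" "computable a" "computable b"
    and zero: "\<And>x. enc (l x) = 0 \<Longrightarrow> f x = a x"
    and Suc: "\<And>x. enc (l x) \<noteq> 0 \<Longrightarrow> \<exists>p. enc (l x) = Suc (enc p) \<and> f x = b (x, p)"
  shows "computable f"
proof -
  obtain rl ra rb where rl: "\<forall>x. rec_eval rl [enc x] = Some (enc (l x))"
    and ra: "\<forall>x. rec_eval ra [enc x] = Some (enc (a x))"
    and rb: "\<forall>x. rec_eval rb [enc x] = Some (enc (b x))"
    using assms by (auto simp: computable_def)
  let ?c = "Comp sub_rf [rl, Comp Succ [Zero]]"
  let ?b = "Comp rb [Comp pair_rf [Proj 0, Comp pred_rf [rl]]]"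
  have "rec_eval (if_rf ?c ra ?b) [enc x] = Some (enc (f x))" for x
  proof (cases "enc (l x) = 0")
    case True
    then have "rec_eval ?c [enc x] = Some (of_bool True)"
      using rl[rule_format, of x] by (simp add: rec_eval_sub)
    from rec_eval_if[OF this] show ?thesis using ra zero[OF True] by simp
  next
    case False
    then have "rec_eval ?c [enc x] = Some (of_bool False)"
      using rl[rule_format, of x] by (simp add: rec_eval_sub)
    moreover from Suc[OF False] obtain p where p: "enc (l x) = Suc (enc p)" "f x = b (x, p)" by blast
    have "rec_eval ?b [enc x] = Some (enc (f x))"
      using rl[rule_format, of x] rb[rule_format, of "(x, p)"] p
      by (simp add: rec_eval_pred rec_eval_pair)
    ultimately show ?thesis by (simp only: rec_eval_if if_False)
  qed
  then show ?thesis by (auto simp: computable_def)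
qed

lemma computable_case_nat [computable_intros]:
  assumes "computable n" "computable a" "computable (\<lambda>z. b (fst z) (snd z))"
  shows "computable (\<lambda>x. case n x of 0 \<Rightarrow> a x | Suc k \<Rightarrow> b x k)"
  using assms by (rule computable_payload) (auto split: nat.splits)

lemma computable_case_option [computable_intros]:
  assumes "computable y" "computable a" "computable (\<lambda>z. b (fst z) (snd z))"
  shows "computable (\<lambda>x. case y x of None \<Rightarrow> a x | Some k \<Rightarrow> b x k)"
  using assms by (rule computable_payload) (auto simp: enc_option_def split: option.splits)

lemma computable_case_list [computable_intros]:
  assumes "computable l" "computable a"
    "computable (\<lambda>z. b (fst z) (fst (snd z)) (snd (snd z)))"
  shows "computable (\<lambda>x. case l x of [] \<Rightarrow> a x | y # ys \<Rightarrow> b x y ys)"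
proof (rule computable_payload[OF assms])
  fix x
  show "enc (l x) = 0 \<Longrightarrow> (case l x of [] \<Rightarrow> a x | y # ys \<Rightarrow> b x y ys) = a x"
    by (cases "l x") simp_all
  show "\<exists>p. enc (l x) = Suc (enc p) \<and> (case l x of [] \<Rightarrow> a x | y # ys \<Rightarrow> b x y ys)
      = b (fst (x, p)) (fst (snd (x, p))) (snd (snd (x, p)))" if "enc (l x) \<noteq> 0"
  proof (cases "l x")
    case (Cons y ys)
    then show ?thesis by (intro exI[of _ "(y, ys)"]) simp
  qed (use that in simp)
qed

lemma computable_Suc [computable_intros]: "computable f \<Longrightarrow> computable (\<lambda>x. Suc (f x))"
proof (rule computable_compose[of Suc])
  have "\<forall>n. rec_eval Succ [enc n] = Some (enc (Suc n))" by simp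
  then show "computable Suc" unfolding computable_def ..
qed

text \<open>\<open>Some\<close> acts on codes as the successor, so a term for the latter serves
  unchanged. In the same way a \<open>Cons\<close> has the code of \<open>Some\<close> of a
  pair.\<close>

lemma computable_Some [computable_intros]: "computable f \<Longrightarrow> computable (\<lambda>x. Some (f x))"
  using computable_Suc[of "\<lambda>x. enc (f x)"]
  by (simp add: computable_def)

lemma computable_Cons [computable_intros]:
  assumes "computable f" "computable g"
  shows "computable (\<lambda>x. f x # g x)"
  using computable_Some[OF computable_Pair[OF assms]] by (simp add: computable_def)

section \<open>Arithmetic, decidable predicates and bounded search\<close>

lemma computable_add [computable_intros]:
  fixes f g :: "'a::coded \<Rightarrow> nat"
  assumes "computable f" "computable g"
  shows "computable (\<lambda>x. f x + g x)"
proof -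
  have "m + n = rec_nat m (\<lambda>i y. Suc y) n" for m n :: nat
    by (induction n) simp_all
  then show ?thesis by simp (intro computable_intros assms)
qed

lemma computable_compose3:
  assumes "computable (\<lambda>z. h (fst z) (fst (snd z)) (snd (snd z)))"
    "computable f" "computable g" "computable k"
  shows "computable (\<lambda>x. h (f x) (g x) (k x))"
  using computable_compose[OF assms(1) computable_Pair[OF assms(2) computable_Pair[OF assms(3,4)]]]
  by simp

lemma computable_mult [computable_intros]:
  fixes f g :: "'a::coded \<Rightarrow> nat"
  assumes "computable f" "computable g"
  shows "computable (\<lambda>x. f x * g x)"
proof -
  have eq: "m * n = rec_nat 0 (\<lambda>i y. y + m) n" for m n :: nat
    by (induction n) simp_all
  show ?thesis unfolding eq by (intro computable_intros computable_compose[OF assms(1)] assms)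
qed

lemma computable_power [computable_intros]:
  fixes f g :: "'a::coded \<Rightarrow> nat"
  assumes "computable f" "computable g"
  shows "computable (\<lambda>x. f x ^ g x)"
proof -
  have eq: "m ^ n = rec_nat 1 (\<lambda>i y. m * y) n" for m n :: nat
    by (induction n) simp_all
  show ?thesis unfolding eq by (intro computable_intros computable_compose[OF assms(1)] assms)
qed

lemma computable_diff [computable_intros]:
  fixes f g :: "'a::coded \<Rightarrow> nat"
  assumes "computable f" "computable g"
  shows "computable (\<lambda>x. f x - g x)"
proof -
  have eq: "m - n = rec_nat m (\<lambda>i y. case y of 0 \<Rightarrow> 0 | Suc k \<Rightarrow> k) n" for m n :: nat
  proof (induction n)
    case (Suc n)
    have "m - Suc n = (case m - n of 0 \<Rightarrow> 0 | Suc k \<Rightarrow> k)" by (auto split: nat.split)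
    then show ?case using Suc by simp
  qed simp
  show ?thesis unfolding eq by (intro computable_intros assms)
qed

lemma computable_not [computable_intros]:
  assumes "computable P"
  shows "computable (\<lambda>x. \<not> P x)"
proof -
  have eq: "(\<not> p) = (if p then False else True)" for p by simp
  show ?thesis by (subst eq) (intro computable_intros assms)
qed

lemma computable_conj [computable_intros]:
  assumes "computable P" "computable Q"
  shows "computable (\<lambda>x. P x \<and> Q x)"
proof -
  have eq: "(p \<and> q) = (if p then q else False)" for p q by simp
  show ?thesis by (subst eq) (intro computable_intros assms)
qed

lemma computable_disj [computable_intros]:
  assumes "computable P" "computable Q"
  shows "computable (\<lambda>x. P x \<or> Q x)"
proof -
  have eq: "(p \<or> q) = (if p then True else q)" for p q by simp
  show ?thesis by (subst eq) (intro computable_intros assms)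
qed

lemma computable_le [computable_intros]:
  fixes f g :: "'a::coded \<Rightarrow> nat"
  assumes "computable f" "computable g"
  shows "computable (\<lambda>x. f x \<le> g x)"
proof -
  have eq: "m \<le> n \<longleftrightarrow> (case m - n of 0 \<Rightarrow> True | Suc k \<Rightarrow> False)" for m n :: nat
    by (auto split: nat.split)
  show ?thesis unfolding eq by (intro computable_intros assms)
qed

lemma computable_less [computable_intros]:
  fixes f g :: "'a::coded \<Rightarrow> nat"
  assumes "computable f" "computable g"
  shows "computable (\<lambda>x. f x < g x)"
  unfolding less_eq_Suc_le by (intro computable_intros assms)

text \<open>Injectivity of \<open>enc\<close> reduces equality at any coded type to equality of
  numbers.\<close>

lemma computable_eq [computable_intros]:
  assumes "computable f" "computable g"
  shows "computable (\<lambda>x. f x = g x)"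
proof -
  have "computable (\<lambda>x. enc (f x))" "computable (\<lambda>x. enc (g x))"
    using assms by (simp_all add: computable_def)
  then have "computable (\<lambda>x. enc (f x) \<le> enc (g x) \<and> enc (g x) \<le> enc (f x))"
    by (intro computable_intros)
  then show ?thesis by (simp flip: eq_iff)
qed

lemma computable_bex [computable_intros]:
  fixes n :: "'a::coded \<Rightarrow> nat"
  assumes "computable (\<lambda>z. P (fst z) (snd z))" "computable n"
  shows "computable (\<lambda>x. \<exists>i<n x. P x i)"
proof -
  have eq: "(\<exists>i<m. Q i) = rec_nat False (\<lambda>i b. b \<or> Q i) m" for m :: nat and Q
    by (induction m) (auto simp: less_Suc_eq)
  show ?thesis unfolding eq by (intro computable_intros computable_compose2[OF assms(1)] assms)
qed

lemma computable_ball [computable_intros]: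
  fixes n :: "'a::coded \<Rightarrow> nat"
  assumes "computable (\<lambda>z. P (fst z) (snd z))" "computable n"
  shows "computable (\<lambda>x. \<forall>i<n x. P x i)"
proof -
  have "computable (\<lambda>x. \<not> (\<exists>i<n x. \<not> P x i))" by (intro computable_intros assms)
  then show ?thesis by simp
qed

lemma computable_sum [computable_intros]:
  fixes g :: "'a::coded \<Rightarrow> nat \<Rightarrow> nat"
  assumes "computable (\<lambda>z. g (fst z) (snd z))" "computable n"
  shows "computable (\<lambda>x. \<Sum>i<n x. g x i)"
proof -
  have eq: "(\<Sum>i<m. h i) = rec_nat 0 (\<lambda>i b. b + h i) m" for m :: nat and h :: "nat \<Rightarrow> nat"
    by (induction m) auto
  show ?thesis unfolding eq by (intro computable_intros computable_compose2[OF assms(1)] assms)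
qed

text \<open>A search that keeps its first hit. Once a hit exists below the bound, the unbounded
  \<open>LEAST\<close> is that first hit.\<close>

lemma computable_Least [computable_intros]:
  fixes n :: "'a::coded \<Rightarrow> nat"
  assumes "computable (\<lambda>z. P (fst z) (snd z))" "computable n"
  shows "computable (\<lambda>x. if \<exists>i<n x. P x i then Some (LEAST i. P x i) else None)"
proof -
  have eq: "(if \<exists>i<m. Q i then Some (LEAST i. Q i) else None)
      = rec_nat None (\<lambda>i y. case y of None \<Rightarrow> if Q i then Some i else None | Some j \<Rightarrow> Some j) m"
    for m :: nat and Q
  proof (induction m)
    case (Suc m)
    consider "\<exists>i<m. Q i" | "\<not> (\<exists>i<m. Q i)" "Q m" | "\<not> (\<exists>i<Suc m. Q i)"
      by (auto simp: less_Suc_eq)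
    then show ?case
    proof cases
      case 1
      then have "\<exists>i<Suc m. Q i" using less_SucI by blast
      with 1 show ?thesis by (simp flip: Suc)
    next
      case 2
      then have "(LEAST i. Q i) = m" by (intro Least_equality) (auto simp: not_less)
      moreover have "\<exists>i<Suc m. Q i" using 2 by blast
      ultimately show ?thesis using 2 by (simp flip: Suc)
    next
      case 3
      then have "\<not> (\<exists>i<m. Q i)" "\<not> Q m" using less_SucI by blast+
      with 3 show ?thesis by (simp flip: Suc)
    qed
  qed simp
  show ?thesis unfolding eq
    by (intro computable_intros computable_compose2[OF assms(1)] assms)
qed

lemma computable_even [computable_intros]:
  fixes f :: "'a::coded \<Rightarrow> nat"
  assumes "computable f"
  shows "computable (\<lambda>x. even (f x))"
proof -
  have eq: "even n = rec_nat True (\<lambda>i b. \<not> b) n" for n :: nat by (induction n) simp_all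
  show ?thesis unfolding eq by (intro computable_intros assms)
qed

lemma computable_div2 [computable_intros]:
  fixes f :: "'a::coded \<Rightarrow> nat"
  assumes "computable f"
  shows "computable (\<lambda>x. f x div 2)"
proof -
  have eq: "n div 2 = rec_nat 0 (\<lambda>i b. if even i then b else Suc b) n" for n :: nat
  proof (induction n)
    case (Suc n)
    have "Suc n div 2 = (if even n then n div 2 else Suc (n div 2))" by auto
    then show ?case using Suc by simp
  qed simp
  show ?thesis unfolding eq by (intro computable_intros assms)
qed

section \<open>List operations, reduced to folds\<close>

lemma length_le_enc: "length xs \<le> enc xs"
proof (induction xs)
  case (Cons x xs)
  then show ?case using le_prod_encode_2[of "enc xs" "enc x"] by simp
qed simp

lemma computable_foldl [computable_intros]:
  assumes "computable (\<lambda>z. g (fst z) (fst (snd z)) (snd (snd z)))" "computable a" "computable l"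
  shows "computable (\<lambda>x. foldl (\<lambda>b y. g x b y) (a x) (l x))"
proof -
  \<comment> \<open>The state holds the remaining list and the accumulator. Rounds after the list is
    exhausted change nothing, so the code of the list, an upper bound for its length, can serve as
    the number of rounds.\<close>
  let ?step = "\<lambda>h i s. case fst s of [] \<Rightarrow> s | y # ys \<Rightarrow> (ys, h (snd s) y)"
  have step: "rec_nat (xs, b) (?step h) n = (drop n xs, foldl h b (take n xs))"
    for xs :: "'c list" and b :: 'b and h n
  proof (induction n)
    case (Suc n)
    show ?case
    proof (cases "n < length xs")
      case True
      then have "drop n xs = xs ! n # drop (Suc n) xs" by (simp add: Cons_nth_drop_Suc)
      with True show ?thesis by (simp add: Suc take_Suc_conv_app_nth)
    qed (simp add: Suc)
  qed simp
  have eq: "foldl h b xs = snd (rec_nat (xs, b) (?step h) (enc xs))"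
    for xs :: "'c list" and b :: 'b and h
    unfolding step using length_le_enc[of xs] by simp
  have "computable (\<lambda>x. enc (l x))" using assms(3) by (simp add: computable_def)
  then show ?thesis
    unfolding eq by (intro computable_intros computable_compose3[OF assms(1)] assms)
qed

lemma computable_rev [computable_intros]:
  assumes "computable l"
  shows "computable (\<lambda>x. rev (l x))"
proof -
  have "foldl (\<lambda>b y. y # b) ys xs = rev xs @ ys" for xs ys :: "'b list"
    by (induction xs arbitrary: ys) simp_all
  then have eq: "rev xs = foldl (\<lambda>b y. y # b) [] xs" for xs :: "'b list" by simp
  show ?thesis unfolding eq by (intro computable_intros assms)
qed

lemma computable_foldr [computable_intros]:
  assumes "computable (\<lambda>z. g (fst z) (fst (snd z)) (snd (snd z)))" "computable a" "computable l"
  shows "computable (\<lambda>x. foldr (\<lambda>y b. g x y b) (l x) (a x))"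
  unfolding foldr_conv_foldl by (intro computable_intros computable_compose3[OF assms(1)] assms)

lemma computable_append [computable_intros]:
  assumes "computable k" "computable l"
  shows "computable (\<lambda>x. k x @ l x)"
proof -
  have eq: "xs @ ys = foldr (\<lambda>y b. y # b) xs ys" for xs ys :: "'b list"
    by (induction xs) simp_all
  show ?thesis unfolding eq by (intro computable_intros assms)
qed

lemma computable_map [computable_intros]:
  fixes g :: "'a::coded \<Rightarrow> 'b::coded \<Rightarrow> 'c::coded"
  assumes "computable (\<lambda>z. g (fst z) (snd z))" "computable l"
  shows "computable (\<lambda>x. map (\<lambda>y. g x y) (l x))"
proof -
  have eq: "map h xs = foldr (\<lambda>y b. h y # b) xs []" for h :: "'b \<Rightarrow> 'c" and xs
    by (induction xs) simp_all
  show ?thesis unfolding eq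
    by (intro computable_intros computable_compose2[OF assms(1)] assms)
qed

lemma computable_filter [computable_intros]:
  assumes "computable (\<lambda>z. P (fst z) (snd z))" "computable l"
  shows "computable (\<lambda>x. filter (\<lambda>y. P x y) (l x))"
proof -
  have eq: "filter Q xs = foldr (\<lambda>y b. if Q y then y # b else b) xs []" for Q and xs :: "'b list"
    by (induction xs) simp_all
  show ?thesis unfolding eq
    by (intro computable_intros computable_compose2[OF assms(1)] assms)
qed

lemma computable_takeWhile [computable_intros]:
  assumes "computable (\<lambda>z. P (fst z) (snd z))" "computable l"
  shows "computable (\<lambda>x. takeWhile (\<lambda>y. P x y) (l x))"
proof -
  have eq: "takeWhile Q xs = foldr (\<lambda>y b. if Q y then y # b else []) xs []"
    for Q and xs :: "'b list"
    by (induction xs) simp_all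
  show ?thesis unfolding eq
    by (intro computable_intros computable_compose2[OF assms(1)] assms)
qed

lemma computable_length [computable_intros]:
  assumes "computable l"
  shows "computable (\<lambda>x. length (l x))"
proof -
  have eq: "length xs = foldr (\<lambda>y n. Suc n) xs 0" for xs :: "'b list"
    by (induction xs) simp_all
  show ?thesis unfolding eq by (intro computable_intros assms)
qed

lemma computable_tl [computable_intros]:
  assumes "computable l"
  shows "computable (\<lambda>x. tl (l x))"
  unfolding tl_def by (intro computable_intros assms)

lemma computable_drop [computable_intros]:
  assumes "computable n" "computable l"
  shows "computable (\<lambda>x. drop (n x) (l x))"
proof -
  have eq: "drop m xs = rec_nat xs (\<lambda>i ys. tl ys) m" for m and xs :: "'b list"
    by (induction m) (simp_all, metis drop_Suc tl_drop)
  show ?thesis unfolding eq by (intro computable_intros assms)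
qed

lemma computable_take [computable_intros]:
  assumes "computable n" "computable l"
  shows "computable (\<lambda>x. take (n x) (l x))"
proof -
  have eq: "take m xs = rev (drop (length xs - m) (rev xs))" for m and xs :: "'b list"
    by (cases "m \<le> length xs") (simp_all add: drop_rev)
  show ?thesis by (subst eq) (intro computable_intros assms)
qed

lemma computable_nth [computable_intros]:
  assumes "computable n" "computable l"
  shows "computable (\<lambda>x. if n x < length (l x) then Some (l x ! n x) else None)"
proof -
  have eq: "(if m < length xs then Some (xs ! m) else None)
      = (case drop m xs of [] \<Rightarrow> None | y # ys \<Rightarrow> Some y)" for m and xs :: "'b list"
    by (simp flip: Cons_nth_drop_Suc)
  show ?thesis unfolding eq by (intro computable_intros assms)
qed

section \<open>Passing between strings and their numbers\<close>

lemma computable_str_code [computable_intros]: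
  assumes "computable s"
  shows "computable (\<lambda>x. str_code (s x))"
proof -
  have eq: "str_code t = foldr (\<lambda>b c. 2 * c + (if b then 2 else 1)) t 0" for t
    by (induction t) simp_all
  show ?thesis unfolding eq by (intro computable_intros assms)
qed

lemma length_le_str_code: "length s \<le> str_code s"
  by (induction s) auto

lemma computable_str_decode: "\<exists>d. computable d \<and> (\<forall>s. d (str_code s) = s)"
proof -
  \<comment> \<open>Inverts the bijective numeration: a nonzero code is even exactly when the first
    bit is \<open>True\<close>, and \<open>(n - 1) div 2\<close> is the code of the tail. The code
    itself bounds the number of bits.\<close>
  define d :: "nat \<Rightarrow> bool list" where
    "d n = snd (rec_nat (n, []) (\<lambda>i z. if fst z = 0 then z
       else ((fst z - 1) div 2, snd z @ [even (fst z)])) n)" for n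
  have *: "rec_nat (str_code s, []) (\<lambda>i z. if fst z = 0 then z
       else ((fst z - 1) div 2, snd z @ [even (fst z)])) n = (str_code (drop n s), take n s)" for s n
  proof (induction n)
    case (Suc n)
    show ?case
    proof (cases "n < length s")
      case True
      then have drop: "drop n s = s ! n # drop (Suc n) s" by (simp add: Cons_nth_drop_Suc)
      show ?thesis using True
        by (simp add: Suc drop take_Suc_conv_app_nth)
    qed (simp add: Suc)
  qed simp
  have "d (str_code s) = s" for s
    unfolding d_def * using length_le_str_code[of s] by simp
  moreover have "computable d" unfolding d_def by (intro computable_intros)
  ultimately show ?thesis by blast
qed

lemma computable_partial_recursive_str:
  fixes C :: "bool list \<Rightarrow> bool list option"
  assumes "computable C"
  shows "partial_recursive_str C"
proof -
  obtain d :: "nat \<Rightarrow> bool list" where d: "computable d" "d (str_code s) = s" for s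
    using computable_str_decode by blast
  have "computable (\<lambda>n. case C (d n) of None \<Rightarrow> 0 | Some t \<Rightarrow> Suc (str_code t))"
    by (intro computable_intros computable_compose[OF assms] computable_compose[OF d(1)])
  then obtain r where "\<And>n. rec_eval r [n]
      = Some (case C (d n) of None \<Rightarrow> 0 | Some t \<Rightarrow> Suc (str_code t))"
    by (auto simp: computable_def)
  then have r: "rec_eval r [str_code s] = Some (case C s of None \<Rightarrow> 0 | Some t \<Rightarrow> Suc (str_code t))" for s
    by (simp add: d(2))
  let ?c = "Comp sub_rf [r, Comp Succ [Zero]]"
  have "rec_eval ?c [str_code s] = Some (of_bool (C s = None))" for s
    by (simp add: r rec_eval_sub split: option.splits)
  \<comment> \<open>\<open>Mu Succ\<close> diverges here: on one argument it calls
    \<open>Succ\<close> with two, where \<open>Succ\<close> is undefined.\<close>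
  then have "rec_eval (if_rf ?c (Mu Succ) (Comp pred_rf [r])) [str_code s]
      = map_option str_code (C s)" for s
    by (simp add: rec_eval_if r rec_eval_pred split: option.splits)
  then show ?thesis unfolding partial_recursive_str_def by blast
qed

section \<open>Bounded evaluation\<close>

text \<open>\<open>rec_eval\<close> with the witness of \<open>Mu\<close> required to lie in \<open>B\<close>. It is total and computable for
  \<open>B = {..<t}\<close>, monotone in \<open>B\<close>, and equal to \<open>rec_eval\<close> for \<open>B = UNIV\<close>.\<close>

fun bounded_eval :: "nat set \<Rightarrow> recf \<Rightarrow> nat list \<Rightarrow> nat option" where
  "bounded_eval B Zero xs = Some 0"
| "bounded_eval B Succ xs = (case xs of [x] \<Rightarrow> Some (Suc x) | _ \<Rightarrow> None)"
| "bounded_eval B (Proj i) xs = (if i < length xs then Some (xs ! i) else None)"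
| "bounded_eval B (Comp f gs) xs = Option.bind (those (map (\<lambda>g. bounded_eval B g xs) gs)) (bounded_eval B f)"
| "bounded_eval B (PrimRec f g) xs =
     (case xs of
        [] \<Rightarrow> None
      | n # ys \<Rightarrow> rec_nat (bounded_eval B f ys) (\<lambda>k r. Option.bind r (\<lambda>y. bounded_eval B g (k # y # ys))) n)"
| "bounded_eval B (Mu f) xs =
     (if \<exists>n\<in>B. bounded_eval B f (n # xs) = Some 0 \<and> (\<forall>k<n. bounded_eval B f (k # xs) \<noteq> None)
      then Some (LEAST n. bounded_eval B f (n # xs) = Some 0)
      else None)"

lemma bounded_eval_UNIV: "bounded_eval UNIV r xs = rec_eval r xs"
proof (induction r arbitrary: xs)
  case (Comp f gs)
  have "map (\<lambda>g. bounded_eval UNIV g xs) gs = map (\<lambda>g. rec_eval g xs) gs"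
    by (rule map_cong[OF refl Comp.IH(2)])
  moreover have "bounded_eval UNIV f = rec_eval f" using Comp.IH(1) by blast
  ultimately show ?case by (simp only: bounded_eval.simps rec_eval.simps)
next
  case (PrimRec f g)
  then show ?case by (simp split: list.split)
qed simp_all

lemma those_eq_Some: "those zs = Some ys \<longleftrightarrow> zs = map Some ys"
  by (induction zs arbitrary: ys) (auto split: option.splits)

text \<open>The delicate case is \<open>Mu\<close>: a witness over \<open>B\<close> guarantees
  values at all smaller arguments. Those values persist over \<open>B'\<close>, so no smaller zero
  can appear and the least zero is unchanged.\<close>

lemma bounded_eval_mono:
  assumes "B \<subseteq> B'" "bounded_eval B r xs = Some y"
  shows "bounded_eval B' r xs = Some y"
  using assms(2)
proof (induction r arbitrary: xs y)
  case (Comp f gs)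
  obtain ys where ys: "those (map (\<lambda>g. bounded_eval B g xs) gs) = Some ys" "bounded_eval B f ys = Some y"
    using Comp.prems by (auto simp: bind_eq_Some_conv)
  from ys(1) have "\<forall>i<length gs. bounded_eval B (gs ! i) xs = Some (ys ! i)" and [simp]: "length ys = length gs"
    by (auto simp: those_eq_Some list_eq_iff_nth_eq dest: arg_cong[of _ _ length])
  then have "those (map (\<lambda>g. bounded_eval B' g xs) gs) = Some ys"
    using Comp.IH(2) by (auto simp: those_eq_Some list_eq_iff_nth_eq)
  then show ?case using Comp.IH(1)[OF ys(2)] by simp
next
  case (PrimRec f g)
  then obtain n ys where xs: "xs = n # ys" by (cases xs) auto
  have "bounded_eval B (PrimRec f g) (n # ys) = Some y \<Longrightarrow> bounded_eval B' (PrimRec f g) (n # ys) = Some y" for y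
    by (induction n arbitrary: y) (auto simp: bind_eq_Some_conv intro: PrimRec.IH)
  then show ?case using PrimRec.prems by (simp only: xs)
next
  case (Mu f)
  let ?P = "\<lambda>B n. bounded_eval B f (n # xs) = Some 0"
  obtain n where n: "n \<in> B" "?P B n" "\<And>k. k < n \<Longrightarrow> bounded_eval B f (k # xs) \<noteq> None"
    and y: "y = (LEAST n. ?P B n)"
    using Mu.prems by (auto split: if_splits)
  have eq: "bounded_eval B' f (k # xs) = bounded_eval B f (k # xs)" if "k \<le> n" for k
    using n(2) n(3)[of k] that Mu.IH[of "k # xs"] by (cases "k = n") auto
  have "(LEAST n. ?P B' n) = (LEAST n. ?P B n)"
  proof (rule Least_equality)
    have "(LEAST n. ?P B n) \<le> n" using n(2) by (rule Least_le)
    then show "?P B' (LEAST n. ?P B n)" using eq LeastI[of "?P B", OF n(2)] by simp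
    fix k
    assume "?P B' k"
    then have "?P B k" if "k \<le> n" using eq[OF that] by simp
    then have "(LEAST n. ?P B n) \<le> k" if "k \<le> n" using that by (simp add: Least_le)
    moreover have "(LEAST n. ?P B n) \<le> n" using n(2) by (rule Least_le)
    ultimately show "(LEAST n. ?P B n) \<le> k" by linarith
  qed
  moreover have "n \<in> B'" "?P B' n" "\<forall>k<n. bounded_eval B' f (k # xs) \<noteq> None"
    using n assms(1) eq by auto
  ultimately show ?case using y by auto
qed simp_all

text \<open>A halting evaluation rests on finitely many subevaluations. Stating the claim with a
  filter combines their stages without explicit maxima; for \<open>Mu\<close> the stage must also
  exceed the witness.\<close>

lemma eventually_bounded_eval:
  assumes "rec_eval r xs = Some y"
  shows "\<forall>\<^sub>F t in sequentially. bounded_eval {..<t} r xs = Some y"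
  using assms
proof (induction r arbitrary: xs y)
  case (Comp f gs)
  obtain ys where ys: "those (map (\<lambda>g. rec_eval g xs) gs) = Some ys" "rec_eval f ys = Some y"
    using Comp.prems by (auto simp: bind_eq_Some_conv)
  from ys(1) have *: "\<forall>i<length gs. rec_eval (gs ! i) xs = Some (ys ! i)" and [simp]: "length ys = length gs"
    by (auto simp: those_eq_Some list_eq_iff_nth_eq dest: arg_cong[of _ _ length])
  have "\<forall>\<^sub>F t in sequentially. \<forall>i\<in>{..<length gs}. bounded_eval {..<t} (gs ! i) xs = Some (ys ! i)"
    using * Comp.IH(2) by (intro eventually_ball_finite) auto
  then show ?case using Comp.IH(1)[OF ys(2)]
  proof eventually_elim
    case (elim t)
    then have "those (map (\<lambda>g. bounded_eval {..<t} g xs) gs) = Some ys"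
      by (auto simp: those_eq_Some list_eq_iff_nth_eq)
    with elim show ?case by simp
  qed
next
  case (PrimRec f g)
  then obtain n ys where xs: "xs = n # ys" by (cases xs) auto
  have "rec_eval (PrimRec f g) (n # ys) = Some y \<Longrightarrow>
      \<forall>\<^sub>F t in sequentially. bounded_eval {..<t} (PrimRec f g) (n # ys) = Some y" for y
  proof (induction n arbitrary: y)
    case (Suc n)
    then obtain z where z: "rec_eval (PrimRec f g) (n # ys) = Some z"
      "rec_eval g (n # z # ys) = Some y"
      by (auto simp: bind_eq_Some_conv)
    from Suc.IH[OF z(1)] PrimRec.IH(2)[OF z(2)] show ?case
      by eventually_elim simp
  qed (use PrimRec.IH(1) in simp)
  then show ?case using PrimRec.prems by (simp only: xs)
next
  case (Mu f)
  let ?P = "\<lambda>n. rec_eval f (n # xs) = Some 0"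
  obtain n where n: "?P n" "\<And>k. k < n \<Longrightarrow> rec_eval f (k # xs) \<noteq> None"
    and y: "y = (LEAST n. ?P n)"
    using Mu.prems by (auto split: if_splits)
  have "\<forall>\<^sub>F t in sequentially. \<forall>k\<in>{..n}. bounded_eval {..<t} f (k # xs) = rec_eval f (k # xs)"
  proof (intro eventually_ball_finite ballI)
    fix k
    assume "k \<in> {..n}"
    then obtain z where "rec_eval f (k # xs) = Some z"
      using n(1) n(2)[of k] by (cases "k = n") auto
    with Mu.IH[OF this] show "\<forall>\<^sub>F t in sequentially. bounded_eval {..<t} f (k # xs) = rec_eval f (k # xs)" by simp
  qed simp
  then show ?case using eventually_gt_at_top[of n]
  proof eventually_elim
    case (elim t)
    have eq: "bounded_eval {..<t} f (k # xs) = rec_eval f (k # xs)" if "k \<le> n" for k using elim that by simp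
    have "(LEAST k. bounded_eval {..<t} f (k # xs) = Some 0) = y"
    proof (rule Least_equality)
      have "y \<le> n" unfolding y using n(1) by (rule Least_le)
      then show "bounded_eval {..<t} f (y # xs) = Some 0" using eq LeastI[of ?P, OF n(1)] by (simp flip: y)
      fix k
      assume "bounded_eval {..<t} f (k # xs) = Some 0"
      then have "?P k" if "k \<le> n" using eq[OF that] by simp
      then have "y \<le> k" if "k \<le> n" using that unfolding y by (simp add: Least_le)
      moreover have "y \<le> n" unfolding y using n(1) by (rule Least_le)
      ultimately show "y \<le> k" by linarith
    qed
    moreover have "\<exists>n\<in>{..<t}. bounded_eval {..<t} f (n # xs) = Some 0 \<and> (\<forall>k<n. bounded_eval {..<t} f (k # xs) \<noteq> None)"
      using n eq elim by (intro bexI[of _ n]) auto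
    ultimately show ?case by simp
  qed
qed simp_all

lemma computable_bind [computable_intros]:
  assumes "computable y" "computable (\<lambda>z. b (fst z) (snd z))"
  shows "computable (\<lambda>x. Option.bind (y x) (\<lambda>k. b x k))"
proof -
  have eq: "Option.bind z f = (case z of None \<Rightarrow> None | Some k \<Rightarrow> f k)"
    for z :: "'b option" and f :: "'b \<Rightarrow> 'c option"
    by (cases z) simp_all
  show ?thesis unfolding eq by (intro computable_intros assms)
qed

lemma computable_map_option [computable_intros]:
  assumes "computable y" "computable (\<lambda>z. b (fst z) (snd z))"
  shows "computable (\<lambda>x. map_option (\<lambda>k. b x k) (y x))"
  unfolding map_option_case by (intro computable_intros assms)

lemma computable_bounded_eval:
  "computable t \<Longrightarrow> computable xs \<Longrightarrow> computable (\<lambda>x. bounded_eval {..<t x} r (xs x))"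
proof -
  have "computable (\<lambda>z :: nat \<times> nat list. bounded_eval {..<fst z} r (snd z))"
  proof (induction r)
    case Zero
    show ?case unfolding bounded_eval.simps by (intro computable_intros)
  next
    case Succ
    show ?case unfolding bounded_eval.simps by (intro computable_intros)
  next
    case (Proj i)
    show ?case unfolding bounded_eval.simps by (intro computable_intros)
  next
    case (Comp f gs)
    have "computable (\<lambda>z. those (map (\<lambda>g. bounded_eval {..<fst z} g (snd z)) gs))"
      using Comp.IH(2)
    proof (induction gs)
      case Nil
      show ?case unfolding list.map those.simps by (intro computable_intros)
    next
      case (Cons g gs)
      show ?case unfolding list.map those.simps
        by (intro computable_intros computable_compose2[OF Cons.IH] computable_compose[OF Cons.IH]
            Cons.prems list.set_intros) (simp_all add: Cons.prems)
    qed
    then show ?case unfolding bounded_eval.simps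
      by (intro computable_intros computable_compose2[OF Comp.IH(1)])
  next
    case (PrimRec f g)
    show ?case unfolding bounded_eval.simps
      by (intro computable_intros computable_compose2[OF PrimRec.IH(1)]
          computable_compose2[OF PrimRec.IH(2)])
  next
    case (Mu f)
    \<comment> \<open>The inner existence test is redundant in value, but it brings the
      \<open>LEAST\<close> into the shape handled by \<open>computable_Least\<close>.\<close>
    have eq: "(if \<exists>n\<in>{..<m}. P n \<and> (\<forall>k<n. Q k) then Some (LEAST n. P n) else None)
      = (if \<exists>n<m. P n \<and> (\<forall>k<n. Q k) then if \<exists>n<m. P n then Some (LEAST n. P n) else None else None)"
      for m :: nat and P Q by auto
    show ?case unfolding bounded_eval.simps eq
      by (intro computable_intros computable_compose2[OF Mu.IH(1)])
  qed
  then show "computable t \<Longrightarrow> computable xs \<Longrightarrow> computable (\<lambda>x. bounded_eval {..<t x} r (xs x))"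
    by (rule computable_compose2)
qed

section \<open>Computability of oracle Turing machine runs\<close>

lemma computable_finite_dom:
  fixes F :: "'a::coded \<Rightarrow> 'b::coded option"
  assumes "finite (dom F)"
  shows "computable F"
  using assms
proof (induction "dom F" arbitrary: F rule: finite_induct)
  case empty
  then have "F = (\<lambda>_. None)" by auto
  then show ?case by (simp add: computable_const)
next
  case (insert k A)
  then have "A = dom (F(k := None))" by auto
  from insert.hyps(3)[OF this] have *: "computable (F(k := None))" .
  have "F = (\<lambda>x. if x = k then F k else (F(k := None)) x)" by auto
  moreover have "computable \<dots>" by (intro computable_intros computable_compose[OF *])
  ultimately show ?case by simp
qed

lemma computable_cell [computable_intros]:
  assumes "computable l"
  shows "computable (\<lambda>x. cell (l x))"
proof -
  have eq: "cell k = (case k of [] \<Rightarrow> Blank | a # _ \<Rightarrow> a)" for k by (cases k) simp_all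
  show ?thesis unfolding eq by (intro computable_intros assms)
qed

lemma computable_tape_read [computable_intros]:
  assumes "computable t"
  shows "computable (\<lambda>x. tape_read (t x))"
  unfolding tape_read_def by (intro computable_intros assms)

lemma computable_tape_write [computable_intros]:
  assumes "computable a" "computable t"
  shows "computable (\<lambda>x. tape_write (a x) (t x))"
proof -
  have eq: "tape_write b u = (fst u, b # tl (snd u))" for b u by (cases u) simp
  show ?thesis unfolding eq by (intro computable_intros assms)
qed

lemma computable_tape_move [computable_intros]:
  assumes "computable d" "computable t"
  shows "computable (\<lambda>x. tape_move (d x) (t x))"
proof -
  have eq: "tape_move e u =
      (if e = Move_Left then (tl (fst u), cell (fst u) # snd u)
       else if e = Move_Right then (cell (snd u) # fst u, tl (snd u)) else u)" for e u
    by (cases u; cases e) simp_all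
  show ?thesis unfolding eq by (intro computable_intros assms)
qed

lemma computable_tape_string [computable_intros]:
  assumes "computable t"
  shows "computable (\<lambda>x. tape_string (t x))"
proof -
  have eq: "leading_bits l
      = map (\<lambda>a. a = Bit True) (takeWhile (\<lambda>a. a = Bit True \<or> a = Bit False) l)" for l
    by (induction l rule: leading_bits.induct) auto
  show ?thesis unfolding tape_string_def eq by (intro computable_intros assms)
qed

lemma computable_otm_init [computable_intros]:
  assumes "computable n"
  shows "computable (\<lambda>x. otm_init M (n x))"
proof -
  have eq: "replicate k (Bit True) = rec_nat [] (\<lambda>i l. Bit True # l) k" for k
    by (induction k) simp_all
  show ?thesis unfolding otm_init_def eq by (intro computable_intros assms)
qed

text \<open>The oracle may vary with \<open>x\<close> as long as membership is decidable uniformly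
  in \<open>x\<close>; this accommodates the finite-stage approximations of a c.e. oracle.\<close>

lemma computable_otm_step:
  assumes "is_oracle_tm M" "computable c" "computable (\<lambda>z. snd z \<in> A (fst z))"
  shows "computable (\<lambda>x. otm_step M (A x) (c x))"
proof -
  have trans: "computable (transition M)"
    using assms(1) unfolding is_oracle_tm_def by (rule computable_finite_dom)
  have eq: "otm_step M B e =
     (if fst e = query_state M
      then Some (if tape_string (snd (snd e)) \<in> B then yes_state M else no_state M, snd e)
      else case transition M (fst e, tape_read (fst (snd e)), tape_read (snd (snd e))) of
             None \<Rightarrow> None
           | Some z \<Rightarrow> Some (fst z,
               tape_move (snd (fst (snd z))) (tape_write (fst (fst (snd z))) (fst (snd e))),
               tape_move (snd (snd (snd z))) (tape_write (fst (snd (snd z))) (snd (snd e)))))" for B e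
    by (cases e) (simp split: option.split)
  show ?thesis unfolding eq
    by (intro computable_intros computable_compose[OF trans] computable_compose[OF assms(2)]
        computable_compose2[OF assms(3)])
qed

definition otm_run :: "oracle_tm \<Rightarrow> bool list set \<Rightarrow> nat \<Rightarrow> nat \<Rightarrow> config" where
  "otm_run M A n t =
     rec_nat (otm_init M n) (\<lambda>_ c. case otm_step M A c of None \<Rightarrow> c | Some c' \<Rightarrow> c') t"

definition otm_result :: "oracle_tm \<Rightarrow> bool list set \<Rightarrow> nat \<Rightarrow> nat \<Rightarrow> bool list option" where
  "otm_result M A n t =
     (case otm_step M A (otm_run M A n t) of
        None \<Rightarrow> Some (tape_string (fst (snd (otm_run M A n t))))
      | Some _ \<Rightarrow> None)"

lemma computable_otm_result:
  assumes "is_oracle_tm M" "computable n" "computable t" "computable (\<lambda>z. snd z \<in> A (fst z))"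
  shows "computable (\<lambda>x. otm_result M (A x) (n x) (t x))"
  unfolding otm_result_def otm_run_def
  by (intro computable_intros computable_otm_step computable_compose[OF assms(2)]
      computable_compose[OF assms(3)] computable_compose2[OF assms(4)] assms(1))

lemma otm_run_halted:
  assumes "otm_step M A (otm_run M A n t) = None"
  shows "otm_run M A n (t + d) = otm_run M A n t"
  by (induction d) (use assms in \<open>simp_all add: otm_run_def\<close>)

lemma otm_result_mono:
  assumes "otm_result M A n t = Some s" "t \<le> t'"
  shows "otm_result M A n t' = Some s"
proof -
  have "otm_step M A (otm_run M A n t) = None"
    using assms(1) by (simp add: otm_result_def split: option.splits)
  from otm_run_halted[OF this, of "t' - t"] assms show ?thesis by (simp add: otm_result_def split: option.splits)
qed

lemma otm_result_unique:
  assumes "otm_result M A n t = Some s" "otm_result M A n t' = Some s'"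
  shows "s = s'"
  using otm_result_mono[OF assms(1), of t'] otm_result_mono[OF assms(2), of t] assms
  by (cases "t \<le> t'") auto

lemma otm_outputs_result:
  assumes "otm_outputs M A n s"
  shows "\<exists>t. otm_result M A n t = Some s"
proof -
  obtain q w u where reach: "(\<lambda>c c'. otm_step M A c = Some c')\<^sup>*\<^sup>* (otm_init M n) (q, w, u)"
    and halt: "otm_step M A (q, w, u) = None" "tape_string w = s"
    using assms by (auto simp: otm_outputs_def)
  from reach have "\<exists>t. otm_run M A n t = (q, w, u)"
  proof (induction rule: rtranclp_induct)
    case base
    have "otm_run M A n 0 = otm_init M n" by (simp add: otm_run_def)
    then show ?case ..
  next
    case (step c c')
    then obtain t where "otm_run M A n t = c" by blast
    with step.hyps have "otm_run M A n (Suc t) = c'" by (simp add: otm_run_def)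
    then show ?case ..
  qed
  with halt show ?thesis unfolding otm_result_def by (metis (no_types, lifting) fst_conv option.case(1) snd_conv)
qed

text \<open>Within a chain of finite sets the cardinality determines the set, and it takes values in
  \<open>{..card D}\<close>, which has \<open>card D + 1\<close> elements.\<close>

lemma card_range_chain:
  fixes A :: "nat \<Rightarrow> 'a set"
  assumes "mono A" "finite D" "\<And>t. A t \<subseteq> D"
  shows "finite (range A) \<and> card (range A) \<le> card D + 1"
proof -
  have "inj_on card (range A)"
  proof (rule inj_onI)
    fix B C
    assume "B \<in> range A" "C \<in> range A" and eq: "card B = card C"
    then obtain i j where ij: "B = A i" "C = A j" by blast
    then have "finite B" "finite C" using assms(2,3) finite_subset by blast+
    moreover have "B \<subseteq> C \<or> C \<subseteq> B"
      unfolding ij using monoD[OF assms(1)] nat_le_linear by blast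
    ultimately show "B = C" using eq card_subset_eq by metis
  qed
  moreover have "card ` range A \<subseteq> {..card D}"
    using assms(2,3) by (auto intro: card_mono)
  ultimately show ?thesis
    using card_inj_on_le[of card "range A" "{..card D}"] inj_on_finite[of card "range A" "{..card D}"]
    by simp
qed

text \<open>By determinism each oracle yields at most one string whatever the running time, so
  distinct results need distinct sets \<open>A t\<close>.\<close>

lemma card_otm_results:
  assumes "mono A" "finite D" "\<And>t. A t \<subseteq> D"
  shows "finite {s. \<exists>t. otm_result M (A t) n t = Some s}"
    and "card {s. \<exists>t. otm_result M (A t) n t = Some s} \<le> card D + 1"
proof -
  let ?R = "{s. \<exists>t. otm_result M (A t) n t = Some s}"
  let ?g = "\<lambda>B. THE s. \<exists>t. otm_result M B n t = Some s"
  note fin = card_range_chain[OF assms]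
  have "?R \<subseteq> ?g ` range A"
  proof
    fix s
    assume "s \<in> ?R"
    then obtain t where t: "otm_result M (A t) n t = Some s" by blast
    then have "?g (A t) = s" using otm_result_unique by (intro the_equality) blast+
    then show "s \<in> ?g ` range A" by blast
  qed
  then show "finite ?R" "card ?R \<le> card D + 1"
    using fin finite_surj[of "range A" ?R ?g] surj_card_le[of "range A" ?R ?g] by auto
qed

section \<open>Binary strings and Kraft's inequality\<close>

lemma finite_bool_lists: "finite {s :: bool list. length s = n}"
  using finite_lists_length_eq[of "UNIV :: bool set" n] by simp

lemma card_bool_lists: "card {s :: bool list. length s = n} = 2 ^ n"
  using card_lists_length_eq[of "UNIV :: bool set" n] by simp

lemma card_extensions:
  assumes "length p \<le> n"
  shows "card {s :: bool list. length s = n \<and> take (length p) s = p} = 2 ^ (n - length p)"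
proof -
  have "{s. length s = n \<and> take (length p) s = p} = (@) p ` {s. length s = n - length p}"
  proof (intro equalityI subsetI)
    fix s
    assume "s \<in> {s. length s = n \<and> take (length p) s = p}"
    then have "s = p @ drop (length p) s" "length (drop (length p) s) = n - length p"
      by (auto, metis append_take_drop_id)
    then show "s \<in> (@) p ` {s. length s = n - length p}" by blast
  qed (use assms in auto)
  then show ?thesis by (simp add: card_image inj_on_def card_bool_lists)
qed

lemma finite_short: "finite {p \<in> D. length (p :: bool list) \<le> n}"
  using finite_lists_length_le[of "UNIV :: bool set" n] by (rule finite_subset[rotated]) auto

text \<open>Incomparable programs have disjoint sets of extensions among the \<open>2 ^ n\<close>
  strings of length \<open>n\<close>.\<close>

lemma Kraft_inequality:
  assumes "prefix_free D"
  shows "(\<Sum>p | p \<in> D \<and> length p \<le> n. 2 ^ (n - length p)) \<le> (2 ^ n :: nat)"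
proof -
  let ?D = "{p. p \<in> D \<and> length p \<le> n}"
  let ?E = "\<lambda>p. {s :: bool list. length s = n \<and> take (length p) s = p}"
  have "(\<Sum>p\<in>?D. 2 ^ (n - length p)) = (\<Sum>p\<in>?D. card (?E p))"
    by (intro sum.cong) (simp_all add: card_extensions)
  also have "\<dots> = card (\<Union>p\<in>?D. ?E p)"
  proof (rule card_UN_disjoint[symmetric])
    show "finite ?D" by (rule finite_short)
    show "\<forall>p\<in>?D. finite (?E p)" using finite_bool_lists[of n] by (auto intro: rev_finite_subset)
    show "\<forall>p\<in>?D. \<forall>q\<in>?D. p \<noteq> q \<longrightarrow> ?E p \<inter> ?E q = {}"
    proof (intro ballI impI)
      fix p q
      assume pq: "p \<in> ?D" "q \<in> ?D" "p \<noteq> q"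
      show "?E p \<inter> ?E q = {}"
      proof (rule ccontr)
        assume "?E p \<inter> ?E q \<noteq> {}"
        then obtain s where "take (length p) s = p" "take (length q) s = q" by blast
        then have "prefix p s" "prefix q s" by (metis take_is_prefix)+
        then have "prefix p q \<or> prefix q p" using prefix_same_cases by blast
        then show False using pq assms unfolding prefix_free_def by blast
      qed
    qed
  qed
  also have "\<dots> \<le> card {s :: bool list. length s = n}"
    by (intro card_mono finite_bool_lists) auto
  finally show ?thesis by (simp add: card_bool_lists)
qed

text \<open>Scaled by \<open>2 ^ t\<close>, this bounds the sum of \<open>2^-n\<close> over all
  pairs of a word and a length \<open>n\<close> at least that of the word. The proof follows the
  recurrences in \<open>t\<close>; there \<open>c t\<close> is the scaled geometric tail that the
  words found so far still contribute beyond \<open>t\<close>.\<close>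

lemma sum_card_short_le:
  assumes "prefix_free D"
  shows "(\<Sum>m<t. card {p \<in> D. length p \<le> Suc m} * 2 ^ (t - Suc m)) \<le> 2 * 2 ^ t"
proof -
  define K where "K t = (\<Sum>p | p \<in> D \<and> length p \<le> t. 2 ^ (t - length p) :: nat)" for t
  define c where "c t = card {p \<in> D. length p \<le> t}" for t
  define e where "e t = card {p \<in> D. length p = t}" for t
  define S where "S t = (\<Sum>m<t. c (Suc m) * 2 ^ (t - Suc m))" for t
  have split: "{p \<in> D. length p \<le> Suc t} = {p \<in> D. length p \<le> t} \<union> {p \<in> D. length p = Suc t}" for t
    by auto
  have fin: "finite {p \<in> D. length p = t}" for t
    using finite_bool_lists[of t] by (rule finite_subset[rotated]) auto
  have c_Suc: "c (Suc t) = c t + e (Suc t)" for t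
    unfolding c_def e_def split by (intro card_Un_disjoint finite_short fin) auto
  have K_Suc: "K (Suc t) = 2 * K t + e (Suc t)" for t
  proof -
    have "K (Suc t) = (\<Sum>p | p \<in> D \<and> length p \<le> t. 2 ^ (Suc t - length p))
        + (\<Sum>p | p \<in> D \<and> length p = Suc t. 2 ^ (Suc t - length p))"
      unfolding K_def split by (intro sum.union_disjoint finite_short fin) auto
    also have "(\<Sum>p | p \<in> D \<and> length p \<le> t. 2 ^ (Suc t - length p)) = 2 * K t"
      unfolding K_def sum_distrib_left by (intro sum.cong) (auto simp: Suc_diff_le)
    also have "(\<Sum>p | p \<in> D \<and> length p = Suc t. 2 ^ (Suc t - length p)) = e (Suc t)"
      by (simp add: e_def)
    finally show ?thesis .
  qed
  have S_Suc: "S (Suc t) = 2 * S t + c (Suc t)" for t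
  proof -
    have "c (Suc m) * 2 ^ (t - m) = 2 * (c (Suc m) * 2 ^ (t - Suc m))" if "m < t" for m
      using that by (simp flip: Suc_diff_Suc)
    then have "(\<Sum>m<t. c (Suc m) * 2 ^ (t - m)) = (\<Sum>m<t. 2 * (c (Suc m) * 2 ^ (t - Suc m)))"
      by (intro sum.cong refl) (simp only: lessThan_iff)
    then show ?thesis by (simp add: S_def sum_distrib_left)
  qed
  \<comment> \<open>the summand \<open>c t\<close> makes the inequality inductive\<close>
  have "S t + c t \<le> 2 * K t"
  proof (induction t)
    case 0
    have "c 0 \<le> K 0" by (simp add: c_def K_def)
    then show ?case by (simp add: S_def)
  next
    case (Suc t)
    then show ?case by (simp add: S_Suc K_Suc c_Suc)
  qed
  moreover have "K t \<le> 2 ^ t" unfolding K_def using assms by (rule Kraft_inequality)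
  ultimately show ?thesis unfolding S_def c_def by linarith
qed

text \<open>Most significant bit first, unlike \<open>str_code\<close>, so that the extensions of a
  string to a fixed length occupy an interval of values.\<close>

definition bin_val :: "bool list \<Rightarrow> nat" where
  "bin_val p = foldl (\<lambda>v b. 2 * v + (if b then 1 else 0)) 0 p"

lemma bin_val_append: "bin_val (p @ q) = bin_val p * 2 ^ length q + bin_val q"
proof -
  have *: "foldl (\<lambda>v b. 2 * v + (if b then 1 else 0)) v q = v * 2 ^ length q + bin_val q" for v
  proof (induction q rule: rev_induct)
    case (snoc b q)
    then show ?case by (simp add: bin_val_def)
  qed (simp add: bin_val_def)
  show ?thesis using *[of "bin_val p"] by (simp only: bin_val_def foldl_append)
qed

lemma bin_val_less: "bin_val p < 2 ^ length p"
  by (induction p rule: rev_induct) (auto simp: bin_val_def)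

lemma bin_val_surj: "v < 2 ^ n \<Longrightarrow> \<exists>p. length p = n \<and> bin_val p = v"
proof (induction n arbitrary: v)
  case 0
  then show ?case by (intro exI[of _ "[]"]) (simp add: bin_val_def)
next
  case (Suc n)
  then have "v div 2 < 2 ^ n" by auto
  then obtain p where "length p = n" "bin_val p = v div 2" using Suc.IH by blast
  then have "length (p @ [odd v]) = Suc n" "bin_val (p @ [odd v]) = v" by (simp_all add: bin_val_def)
  then show ?case by blast
qed

definition bool_lists :: "nat \<Rightarrow> bool list list" where
  "bool_lists n = rec_nat [[]] (\<lambda>_ L. map ((#) True) L @ map ((#) False) L) n"

lemma set_bool_lists: "set (bool_lists n) = {s. length s = n}"
proof (induction n)
  case (Suc n)
  have "{s. length s = Suc n} = (#) True ` {s. length s = n} \<union> (#) False ` {s. length s = n}"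
    by (auto simp: length_Suc_conv image_iff)
  then show ?case using Suc by (simp add: bool_lists_def)
qed (simp add: bool_lists_def)

lemma distinct_bool_lists: "distinct (bool_lists n)"
  by (induction n) (auto simp: bool_lists_def distinct_map)

lemma length_filter_bool_lists:
  "length (filter P (bool_lists n)) = card {s. length s = n \<and> P s}"
  using distinct_card[of "filter P (bool_lists n)"] distinct_bool_lists
  by (simp add: set_bool_lists)

section \<open>An integral test and its Kraft-Chaitin coding\<close>

text \<open>This is all that is kept of \<open>M\<close> and \<open>V\<close>: computable candidates
  \<open>out\<close>, few for each \<open>n\<close> as measured by a prefix-free set. Computability
  is required of \<open>f (Suc n)\<close> because \<open>f 0\<close> is arbitrary.\<close>

locale approximation_test =
  fixes f :: "nat \<Rightarrow> nat" and out :: "nat \<Rightarrow> nat \<Rightarrow> bool list option" and D :: "bool list set"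
  assumes computable_f: "computable (\<lambda>n. f (Suc n))"
    and computable_out: "computable (\<lambda>z. out (fst z) (snd z))"
    and prefix_free_D: "prefix_free D"
    and finite_out: "finite {s. \<exists>t. out n t = Some s}"
    and card_out: "card {s. \<exists>t. out n t = Some s} \<le> card {p \<in> D. length p \<le> n} + 1"
begin

text \<open>\<open>weight t s\<close> is \<open>2\<^sup>t\<close> times the stage-\<open>t\<close> approximation of the test function on the
  cylinder of \<open>s\<close>, where \<open>length s = t\<close>.\<close>

definition weight :: "nat \<Rightarrow> bool list \<Rightarrow> nat" where
  "weight t s = (\<Sum>m<t. if f (Suc m) \<le> Suc m \<and>
       (\<exists>i<t. out (Suc m) i = Some (take (Suc m - f (Suc m)) s))
     then 2 ^ (t - f (Suc m)) else 0)"

text \<open>Scaled threshold \<open>2 ^ (k + 2)\<close>, that is \<open>4 * 2 ^ k\<close>; the 4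
  absorbs the bound 3 on the mean weight.\<close>

definition heavy :: "nat \<Rightarrow> nat \<Rightarrow> bool list \<Rightarrow> bool" where
  "heavy k t s \<longleftrightarrow> 2 ^ (t + k + 2) \<le> weight t s"

definition heavy_count :: "nat \<Rightarrow> nat \<Rightarrow> nat" where
  "heavy_count k t = length (filter (\<lambda>s. heavy k t s) (bool_lists t))"

definition fresh :: "nat \<Rightarrow> nat \<Rightarrow> bool list list" where
  "fresh k t = filter (\<lambda>s. heavy k t s \<and> \<not> heavy k (t - 1) (take (t - 1) s)) (bool_lists t)"

text \<open>Programs of length \<open>t - k\<close> describe the strings of length \<open>t\<close> that become heavy at stage \<open>t\<close>.
  The program values below \<open>2 * heavy_count k (t - 1)\<close> are left out because they extend programs
  of shorter strings.\<close>

definition block :: "nat \<Rightarrow> bool list \<Rightarrow> bool list option" where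
  "block k p =
     (if 2 * heavy_count k (length p + k - 1) \<le> bin_val p
      then if bin_val p - 2 * heavy_count k (length p + k - 1) < length (fresh k (length p + k))
        then Some (fresh k (length p + k) ! (bin_val p - 2 * heavy_count k (length p + k - 1)))
        else None
      else None)"

text \<open>The prefix \<open>1\<^sup>j0\<close> selects the gain \<open>2 * j\<close>, half of which is spent on the prefix itself.\<close>

definition machine :: "bool list \<Rightarrow> bool list option" where
  "machine q =
     (if length (takeWhile (\<lambda>b. b) q) < length q
      then block (2 * length (takeWhile (\<lambda>b. b) q)) (drop (Suc (length (takeWhile (\<lambda>b. b) q))) q)
      else None)"

section \<open>Computability of the coding machine\<close>

lemma computable_heavy [computable_intros]:
  assumes "computable k" "computable t" "computable s"
  shows "computable (\<lambda>x. heavy (k x) (t x) (s x))"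
  unfolding heavy_def weight_def
  by (intro computable_intros computable_compose[OF computable_f]
      computable_compose2[OF computable_out] computable_compose[OF assms(1)]
      computable_compose[OF assms(2)] computable_compose[OF assms(3)])

lemma computable_bool_lists [computable_intros]:
  assumes "computable n"
  shows "computable (\<lambda>x. bool_lists (n x))"
  unfolding bool_lists_def by (intro computable_intros assms)

lemma computable_heavy_count [computable_intros]:
  assumes "computable k" "computable t"
  shows "computable (\<lambda>x. heavy_count (k x) (t x))"
  unfolding heavy_count_def
  by (intro computable_intros computable_compose[OF assms(1)] computable_compose[OF assms(2)])

lemma computable_fresh [computable_intros]:
  assumes "computable k" "computable t"
  shows "computable (\<lambda>x. fresh (k x) (t x))"
  unfolding fresh_def
  by (intro computable_intros computable_compose[OF assms(1)] computable_compose[OF assms(2)])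

lemma computable_block [computable_intros]:
  assumes "computable k" "computable p"
  shows "computable (\<lambda>x. block (k x) (p x))"
  unfolding block_def bin_val_def
  by (intro computable_intros computable_compose[OF assms(1)] computable_compose[OF assms(2)])

lemma computable_machine: "computable machine"
  unfolding machine_def by (intro computable_intros)

text \<open>Union bound over the candidates of length \<open>n - f n\<close>. The two exponents add
  up to \<open>(t - n) + t\<close>, so \<open>f n\<close> cancels; one factor \<open>2 ^ t\<close>
  is the weight scale, the other the number of strings.\<close>

lemma card_hit_le:
  assumes "f n \<le> n" "n \<le> t"
  shows "card {s. length s = t \<and> (\<exists>i<t. out n i = Some (take (n - f n) s))} * 2 ^ (t - f n)
    \<le> (card {p \<in> D. length p \<le> n} + 1) * 2 ^ (t - n) * 2 ^ t"
proof -
  let ?R = "{s. \<exists>t. out n t = Some s}"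
  let ?R' = "{s \<in> ?R. length s = n - f n}"
  let ?E = "\<lambda>p. {s :: bool list. length s = t \<and> take (length p) s = p}"
  have finR: "finite ?R'" using finite_out by simp
  have "{s. length s = t \<and> (\<exists>i<t. out n i = Some (take (n - f n) s))} \<subseteq> (\<Union>p\<in>?R'. ?E p)"
    using assms by auto
  then have "card {s. length s = t \<and> (\<exists>i<t. out n i = Some (take (n - f n) s))} \<le> card (\<Union>p\<in>?R'. ?E p)"
    by (intro card_mono finite_UN_I finR) (auto intro: finite_subset[OF _ finite_bool_lists[of t]])
  also have "\<dots> \<le> (\<Sum>p\<in>?R'. card (?E p))" by (rule card_UN_le[OF finR])
  also have "\<dots> = (\<Sum>p\<in>?R'. 2 ^ (t - (n - f n)))"
  proof (intro sum.cong refl)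
    fix p
    assume p: "p \<in> ?R'"
    then have "length p \<le> t" using assms by auto
    from card_extensions[OF this] p show "card (?E p) = 2 ^ (t - (n - f n))" by simp
  qed
  also have "\<dots> = card ?R' * 2 ^ (t - (n - f n))" by simp
  also have "card ?R' \<le> card ?R" by (intro card_mono finite_out) auto
  also have "card ?R \<le> card {p \<in> D. length p \<le> n} + 1" by (rule card_out)
  finally have "card {s. length s = t \<and> (\<exists>i<t. out n i = Some (take (n - f n) s))}
      \<le> (card {p \<in> D. length p \<le> n} + 1) * 2 ^ (t - (n - f n))" by simp
  then have "card {s. length s = t \<and> (\<exists>i<t. out n i = Some (take (n - f n) s))} * 2 ^ (t - f n)
      \<le> (card {p \<in> D. length p \<le> n} + 1) * 2 ^ (t - (n - f n)) * 2 ^ (t - f n)"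
    by (rule mult_right_mono) simp
  also have "\<dots> = (card {p \<in> D. length p \<le> n} + 1) * 2 ^ ((t - (n - f n)) + (t - f n))"
    by (simp only: power_add mult.assoc)
  also have "(t - (n - f n)) + (t - f n) = (t - n) + t" using assms by simp
  finally show ?thesis by (simp only: power_add mult.assoc)
qed

text \<open>After exchanging the sums, \<open>card {p \<in> D. length p \<le> n}\<close> accounts
  for 2 and the added 1 for a geometric series below 1.\<close>

lemma sum_weight_le: "(\<Sum>s | length s = t. weight t s) \<le> 3 * 2 ^ t * 2 ^ t"
proof -
  let ?c = "\<lambda>m. card {p \<in> D. length p \<le> Suc m}"
  let ?h = "\<lambda>m s. \<exists>i<t. out (Suc m) i = Some (take (Suc m - f (Suc m)) s)"
  have "(\<Sum>s | length s = t. weight t s) = (\<Sum>m<t. \<Sum>s | length s = t.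
      if f (Suc m) \<le> Suc m \<and> ?h m s then 2 ^ (t - f (Suc m)) else 0)"
    unfolding weight_def by (rule sum.swap)
  also have "\<dots> \<le> (\<Sum>m<t. (?c m + 1) * 2 ^ (t - Suc m) * 2 ^ t)"
  proof (rule sum_mono)
    fix m
    assume m: "m \<in> {..<t}"
    show "(\<Sum>s | length s = t. if f (Suc m) \<le> Suc m \<and> ?h m s then 2 ^ (t - f (Suc m)) else 0)
      \<le> (?c m + 1) * 2 ^ (t - Suc m) * 2 ^ t"
    proof (cases "f (Suc m) \<le> Suc m")
      case True
      then have "(\<Sum>s | length s = t. if f (Suc m) \<le> Suc m \<and> ?h m s then 2 ^ (t - f (Suc m)) else 0)
          = (\<Sum>s | length s = t \<and> ?h m s. 2 ^ (t - f (Suc m)))"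
        using finite_bool_lists[of t] by (intro sum.mono_neutral_cong_right) auto
      also have "\<dots> = card {s. length s = t \<and> ?h m s} * 2 ^ (t - f (Suc m))" by simp
      also have "\<dots> \<le> (?c m + 1) * 2 ^ (t - Suc m) * 2 ^ t"
        using card_hit_le[OF True] m by auto
      finally show ?thesis .
    qed simp
  qed
  also have "\<dots> = ((\<Sum>m<t. ?c m * 2 ^ (t - Suc m)) + (\<Sum>m<t. 2 ^ (t - Suc m))) * 2 ^ t"
    by (simp only: sum_distrib_right sum.distrib distrib_right mult_1_left)
  also have "\<dots> \<le> (2 * 2 ^ t + 2 ^ t) * 2 ^ t"
  proof (intro mult_right_mono add_mono sum_card_short_le prefix_free_D)
    have "(\<Sum>m<t. 2 ^ (t - Suc m)) = (\<Sum>m<t. 2 ^ m :: nat)" by (rule sum.nat_diff_reindex)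
    then show "(\<Sum>m<t. 2 ^ (t - Suc m)) \<le> (2 ^ t :: nat)" by (simp add: sum_power2 lessThan_atLeast0)
  qed simp
  finally show ?thesis by simp
qed

text \<open>Markov's inequality: at least \<open>2 ^ (t + k + 2)\<close> per heavy string against a
  total of at most \<open>3 * 2 ^ t * 2 ^ t\<close>.\<close>

lemma heavy_count_le: "heavy_count k t * 2 ^ k \<le> 2 ^ t"
proof -
  let ?H = "{s. length s = t \<and> heavy k t s}"
  have "heavy_count k t * 2 ^ k * (4 * 2 ^ t) = (\<Sum>s\<in>?H. 2 ^ (t + k + 2))"
    unfolding heavy_count_def length_filter_bool_lists by (simp add: power_add)
  also have "\<dots> \<le> (\<Sum>s\<in>?H. weight t s)" by (rule sum_mono) (simp add: heavy_def)
  also have "\<dots> \<le> (\<Sum>s | length s = t. weight t s)"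
    by (intro sum_mono2 finite_bool_lists) auto
  also have "\<dots> \<le> 2 ^ t * (4 * 2 ^ t)" using sum_weight_le[of t] by simp
  finally show ?thesis by simp
qed

text \<open>One more stage doubles the scale, keeps every earlier hit and can only add new
  ones.\<close>

lemma weight_Suc: "2 * weight t (take t s) \<le> weight (Suc t) s"
proof -
  let ?g = "\<lambda>t s m. if f (Suc m) \<le> Suc m \<and>
       (\<exists>i<t. out (Suc m) i = Some (take (Suc m - f (Suc m)) s))
     then 2 ^ (t - f (Suc m)) else 0 :: nat"
  have "2 * ?g t (take t s) m \<le> ?g (Suc t) s m" if "m < t" for m
  proof (cases "f (Suc m) \<le> Suc m \<and> (\<exists>i<t. out (Suc m) i = Some (take (Suc m - f (Suc m)) (take t s)))")
    case True
    then obtain i where "i < t" "out (Suc m) i = Some (take (Suc m - f (Suc m)) (take t s))" by blast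
    \<comment> \<open>The candidate is no longer than \<open>Suc m\<close>, hence than
      \<open>t\<close>, so cutting \<open>s\<close> to length \<open>t\<close> does not affect
      it.\<close>
    moreover have "min (Suc m - f (Suc m)) t = Suc m - f (Suc m)" using that by simp
    ultimately have "i < Suc t" "out (Suc m) i = Some (take (Suc m - f (Suc m)) s)" by (simp_all add: min.commute)
    then have "\<exists>i<Suc t. out (Suc m) i = Some (take (Suc m - f (Suc m)) s)" by blast
    with True that show ?thesis by (simp add: Suc_diff_le)
  qed auto
  then have "(\<Sum>m<t. 2 * ?g t (take t s) m) \<le> (\<Sum>m<t. ?g (Suc t) s m)" by (intro sum_mono) simp
  also have "\<dots> \<le> (\<Sum>m<Suc t. ?g (Suc t) s m)" by (intro sum_mono2) auto
  finally show ?thesis unfolding weight_def sum_distrib_left .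
qed

lemma heavy_Suc: "heavy k t (take t s) \<Longrightarrow> heavy k (Suc t) s"
  using weight_Suc[of t s] by (simp add: heavy_def)

text \<open>Both one-bit extensions of a heavy string are heavy; every other heavy string is
  fresh.\<close>

lemma heavy_count_Suc: "heavy_count k (Suc t) = 2 * heavy_count k t + length (fresh k (Suc t))"
proof -
  let ?H = "{s. length s = t \<and> heavy k t s}"
  let ?A = "{s. length s = Suc t \<and> heavy k t (take t s)}"
  let ?B = "{s. length s = Suc t \<and> heavy k (Suc t) s \<and> \<not> heavy k t (take t s)}"
  have fin: "finite {s :: bool list. length s = n \<and> P s}" for n P
    using finite_bool_lists[of n] by (rule finite_subset[rotated]) auto
  have "?A = (\<lambda>(s, b). s @ [b]) ` (?H \<times> UNIV)"
  proof (intro equalityI subsetI)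
    fix s
    assume s: "s \<in> ?A"
    then have "s = take t s @ [s ! t]" "take t s \<in> ?H"
      by (simp_all add: take_Suc_conv_app_nth[symmetric])
    then show "s \<in> (\<lambda>(s, b). s @ [b]) ` (?H \<times> UNIV)" by (auto intro: image_eqI[of _ _ "(take t s, s ! t)"])
  qed auto
  moreover have "inj_on (\<lambda>(s, b). s @ [b]) (?H \<times> UNIV)" by (auto intro: inj_onI)
  ultimately have "card ?A = 2 * card ?H" by (simp add: card_image card_cartesian_product)
  moreover have "{s. length s = Suc t \<and> heavy k (Suc t) s} = ?A \<union> ?B" using heavy_Suc by auto
  then have "card {s. length s = Suc t \<and> heavy k (Suc t) s} = card ?A + card ?B"
    by (simp only:) (intro card_Un_disjoint fin, auto)
  ultimately show ?thesis
    unfolding heavy_count_def fresh_def length_filter_bool_lists by simp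
qed

section \<open>Prefix-freeness of the coding\<close>

lemma fresh_0: "fresh k 0 = []"
  by (simp add: fresh_def heavy_def weight_def)

lemma heavy_count_growth: "2 ^ d * heavy_count k t \<le> heavy_count k (t + d)"
  by (induction d) (simp_all add: heavy_count_Suc)

lemma block_dom:
  assumes "block k p = Some s"
  shows "0 < length p + k" "2 * heavy_count k (length p + k - 1) \<le> bin_val p"
    "bin_val p < heavy_count k (length p + k)"
proof -
  \<comment> \<open>Makes the truncated \<open>length p + k - 1\<close> a genuine predecessor; at
    stage 0 nothing is fresh.\<close>
  show pos: "0 < length p + k"
    using assms by (cases "length p + k") (auto simp: block_def fresh_0 split: if_splits)
  show lo: "2 * heavy_count k (length p + k - 1) \<le> bin_val p"
    using assms by (auto simp: block_def split: if_splits)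
  have "bin_val p - 2 * heavy_count k (length p + k - 1) < length (fresh k (length p + k))"
    using assms by (auto simp: block_def split: if_splits)
  then show "bin_val p < heavy_count k (length p + k)"
    using heavy_count_Suc[of k "length p + k - 1"] pos lo by simp
qed

text \<open>All proper extensions of a used program have values below twice the heavy count of the
  preceding stage, where the interval of used programs of the longer length begins.\<close>

lemma block_prefix_free:
  assumes "block k p = Some s" "block k p' = Some s'" "prefix p p'"
  shows "p = p'"
proof (rule ccontr)
  assume ne: "p \<noteq> p'"
  obtain q where q: "p' = p @ q" using assms(3) by (auto elim: prefixE)
  with ne have "q \<noteq> []" by auto
  \<comment> \<open>One factor 2 is set aside for that left endpoint; the other \<open>d\<close>
    doublings are absorbed by \<open>heavy_count_growth\<close>.\<close>
  then obtain d where d: "length q = Suc d" by (cases q) auto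
  note a = block_dom[OF assms(1)] and b = block_dom[OF assms(2)]
  have "bin_val p' < (bin_val p + 1) * 2 ^ length q"
    using bin_val_less[of q] by (simp add: q bin_val_append)
  also have "\<dots> \<le> heavy_count k (length p + k) * 2 ^ length q"
    using a(3) by (intro mult_right_mono) auto
  also have "\<dots> = 2 * (2 ^ d * heavy_count k (length p + k))" by (simp add: d)
  also have "\<dots> \<le> 2 * heavy_count k (length p + k + d)" using heavy_count_growth by simp
  also have "\<dots> = 2 * heavy_count k (length p' + k - 1)" by (simp add: q d add_ac)
  also have "\<dots> \<le> bin_val p'" by (rule b(2))
  finally show False by simp
qed

lemma takeWhile_less_append:
  assumes "length (takeWhile P p) < length p"
  shows "takeWhile P (p @ q) = takeWhile P p"
proof -
  have "\<exists>x\<in>set p. \<not> P x"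
    using assms by (metis less_irrefl takeWhile_eq_all_conv)
  then show ?thesis by (auto simp: takeWhile_append1)
qed

lemma computer_machine: "computer machine"
  unfolding computer_def prefix_free_def
proof (intro conjI ballI impI)
  show "partial_recursive_str machine"
    by (rule computable_partial_recursive_str[OF computable_machine])
  fix p p'
  assume "p \<in> dom machine" "p' \<in> dom machine" and pre: "prefix p p'"
  then obtain s s' where s: "machine p = Some s" "machine p' = Some s'" by blast
  let ?j = "\<lambda>p. length (takeWhile (\<lambda>b. b) p)"
  obtain q where q: "p' = p @ q" using pre by (auto elim: prefixE)
  have less: "?j p < length p" using s(1) by (auto simp: machine_def split: if_splits)
  then have j: "?j p' = ?j p" unfolding q by (simp only: takeWhile_less_append)
  have "block (2 * ?j p) (drop (Suc (?j p)) p) = Some s"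
    using s(1) by (auto simp: machine_def split: if_splits)
  moreover have "block (2 * ?j p) (drop (Suc (?j p)) p') = Some s'"
    using s(2) unfolding machine_def j by (auto split: if_splits)
  moreover have "prefix (drop (Suc (?j p)) p) (drop (Suc (?j p)) p')"
    using less by (simp add: q)
  ultimately have "drop (Suc (?j p)) p = drop (Suc (?j p)) p'" by (rule block_prefix_free)
  then show "p = p'" using less by (simp add: q)
qed

text \<open>At the first stage where a prefix of \<open>a\<close> is heavy, that prefix is fresh,
  and its position in \<open>fresh\<close> determines the program. \<open>heavy_count_le\<close>
  ensures that the value fits into \<open>n - k\<close> bits.\<close>

lemma exists_program:
  assumes "heavy k t (map a [0..<t])"
  shows "\<exists>n\<ge>1. \<exists>p. length p + k = n \<and> block k p = Some (map a [0..<n])"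
proof -
  define n where "n = (LEAST t. heavy k t (map a [0..<t]))"
  have n: "heavy k n (map a [0..<n])" unfolding n_def using assms by (rule LeastI)
  have "\<not> heavy k 0 (map a [0..<0])" by (simp add: heavy_def weight_def)
  with n have "n \<ge> 1" by (cases n) auto
  then have "\<not> heavy k (n - 1) (map a [0..<n - 1])"
    unfolding n_def by (intro not_less_Least) simp
  then have "map a [0..<n] \<in> set (fresh k n)"
    using n by (simp add: fresh_def set_bool_lists take_map)
  then obtain i where i: "i < length (fresh k n)" "fresh k n ! i = map a [0..<n]"
    by (auto simp: in_set_conv_nth)
  let ?v = "2 * heavy_count k (n - 1) + i"
  have "?v < heavy_count k n" using heavy_count_Suc[of k "n - 1"] i(1) \<open>n \<ge> 1\<close> by simp
  then have "?v * 2 ^ k < heavy_count k n * 2 ^ k" by simp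
  also have "\<dots> \<le> 2 ^ n" by (rule heavy_count_le)
  finally have v: "?v * 2 ^ k < 2 ^ n" .
  \<comment> \<open>At least one string is heavy, so the same bound gives \<open>k \<le> n\<close>
    and the length \<open>n - k\<close> is not truncated.\<close>
  have "1 * 2 ^ k \<le> heavy_count k n * 2 ^ k" using \<open>?v < _\<close> by (intro mult_right_mono) auto
  also have "\<dots> \<le> 2 ^ n" by (rule heavy_count_le)
  finally have "k \<le> n" by simp
  with v have "?v * 2 ^ k < 2 ^ (n - k) * 2 ^ k" by (simp flip: power_add)
  then have "?v < 2 ^ (n - k)" by simp
  then obtain p where p: "length p = n - k" "bin_val p = ?v" using bin_val_surj by blast
  have len: "length p + k = n" using p(1) \<open>k \<le> n\<close> by simp
  then have "block k p = Some (map a [0..<n])" unfolding block_def len p(2) using i by simp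
  with len \<open>n \<ge> 1\<close> show ?thesis by blast
qed

lemma exists_heavy:
  assumes a: "\<And>n. 1 \<le> n \<Longrightarrow> f n \<le> n \<Longrightarrow> \<exists>t. out n t = Some (map a [0..<n - f n])"
    and div: "\<not> summable (\<lambda>n. 2 powr (- real (f (n + 1))))"
  shows "\<exists>t. heavy k t (map a [0..<t])"
proof -
  \<comment> \<open>Drops the \<open>n\<close> with \<open>f n > n\<close>, for which the
    restriction is empty. Their terms are dominated by a geometric series, so divergence
    survives.\<close>
  define g :: "nat \<Rightarrow> real" where
    "g m = (if f (Suc m) \<le> Suc m then 2 powr (- real (f (Suc m))) else 0)" for m
  have "\<not> summable g"
  proof
    assume "summable g"
    then have "summable (\<lambda>m. g m + (1 / 2) ^ m)"
      by (intro summable_add summable_geometric) simp_all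
    moreover have "norm (2 powr (- real (f (m + 1)))) \<le> g m + (1 / 2) ^ m" for m
    proof (cases "f (Suc m) \<le> Suc m")
      case False
      then have "2 powr (- real (f (m + 1))) \<le> (2 :: real) powr (- real m)"
        by (intro powr_mono) auto
      also have "\<dots> = (1 / 2) ^ m"
        by (simp add: powr_minus powr_realpow power_one_over inverse_eq_divide)
      finally show ?thesis using False by (simp add: g_def)
    qed (simp add: g_def)
    ultimately have "summable (\<lambda>m. 2 powr (- real (f (m + 1))))"
      by (rule summable_comparison_test'[where N = 0])
    with div show False by contradiction
  qed
  moreover have "0 \<le> g m" for m by (simp add: g_def)
  ultimately have "\<not> (\<forall>N. (\<Sum>m<N. g m) \<le> 2 ^ (k + 2))"
    using summableI_nonneg_bounded[of g] by metis
  then obtain N where N: "(\<Sum>m<N. g m) > 2 ^ (k + 2)" by (auto simp: not_le)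
  have "\<exists>h. \<forall>m. f (Suc m) \<le> Suc m \<longrightarrow> out (Suc m) (h m) = Some (map a [0..<Suc m - f (Suc m)])"
    using a by (intro choice) simp
  then obtain h where h: "\<And>m. f (Suc m) \<le> Suc m \<Longrightarrow>
      out (Suc m) (h m) = Some (map a [0..<Suc m - f (Suc m)])" by blast
  \<comment> \<open>Late enough for the sum in \<open>weight\<close> to contain the first
    \<open>N\<close> indices and for each of their candidates, found at \<open>h m\<close>, to have
    appeared.\<close>
  define t where "t = Suc (N + (\<Sum>m<N. h m))"
  have ht: "h m < t" if "m < N" for m
    using member_le_sum[of m "{..<N}" h] that by (simp add: t_def)
  have le: "2 ^ t * g m \<le> real (if f (Suc m) \<le> Suc m \<and>
      (\<exists>i<t. out (Suc m) i = Some (take (Suc m - f (Suc m)) (map a [0..<t])))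
      then 2 ^ (t - f (Suc m)) else 0)" if "m < N" for m
  proof (cases "f (Suc m) \<le> Suc m")
    case True
    have "take (Suc m - f (Suc m)) (map a [0..<t]) = map a [0..<Suc m - f (Suc m)]"
      using that by (simp add: take_map t_def)
    then have "\<exists>i<t. out (Suc m) i = Some (take (Suc m - f (Suc m)) (map a [0..<t]))"
      using h[OF True] ht[OF that] by metis
    moreover have "2 ^ t * g m = 2 ^ (t - f (Suc m))"
      using True that by (simp add: g_def powr_minus powr_realpow power_diff t_def field_simps)
    ultimately show ?thesis using True by simp
  qed (simp add: g_def)
  have "2 ^ (t + k + 2) \<le> (2 ^ t * (\<Sum>m<N. g m) :: real)"
    using N by (simp add: power_add mult.assoc)
  also have "\<dots> \<le> (\<Sum>m<N. real (if f (Suc m) \<le> Suc m \<and>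
      (\<exists>i<t. out (Suc m) i = Some (take (Suc m - f (Suc m)) (map a [0..<t])))
      then 2 ^ (t - f (Suc m)) else 0))"
    unfolding sum_distrib_left using le by (intro sum_mono) blast
  also have "\<dots> \<le> real (weight t (map a [0..<t]))"
    unfolding weight_def of_nat_sum by (intro sum_mono2) (auto simp: t_def)
  finally have "2 ^ (t + k + 2) \<le> weight t (map a [0..<t])"
    by (metis of_nat_le_iff of_nat_numeral of_nat_power)
  then show ?thesis unfolding heavy_def by blast
qed

text \<open>The selector costs \<open>j + 1\<close> bits and the block saves \<open>2 * j\<close>,
  leaving a program of length \<open>n + 1 - j\<close>.\<close>

lemma machine_compresses:
  assumes "\<And>n. 1 \<le> n \<Longrightarrow> f n \<le> n \<Longrightarrow> \<exists>t. out n t = Some (map a [0..<n - f n])"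
    and "\<not> summable (\<lambda>n. 2 powr (- real (f (n + 1))))"
  shows "\<exists>n\<ge>1. \<exists>q. machine q = Some (map a [0..<n]) \<and> length q + j = n + 1"
proof -
  from exists_heavy[OF assms] obtain t where "heavy (2 * j) t (map a [0..<t])" by blast
  from exists_program[OF this] obtain n p where
    p: "n \<ge> 1" "length p + 2 * j = n" "block (2 * j) p = Some (map a [0..<n])" by blast
  let ?q = "replicate j True @ False # p"
  have "takeWhile (\<lambda>b. b) ?q = replicate j True" by (simp add: takeWhile_append)
  then have "machine ?q = Some (map a [0..<n])" using p(3) by (simp add: machine_def)
  moreover have "length ?q + j = n + 1" using p(2) by simp
  ultimately show ?thesis using p(1) by blast
qed

end

theorem theorem3p3:
  fixes U V :: "bool list \<Rightarrow> bool list option"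
    and \<alpha> :: real
    and f :: "nat \<Rightarrow> nat"
  assumes "optimal_computer U"
    and "weakly_Chaitin_random U \<alpha>"
    and "optimal_computer V"
    and "total_recursive_pos f"
    and "\<exists>M. is_oracle_tm M \<and>
           (\<forall>n::nat. 1 \<le> n \<longrightarrow>
              otm_outputs M (set_restrict (dom V) (int n)) n
                (real_restrict \<alpha> (int n - int (f n))))"
  shows "summable (\<lambda>n::nat. 2 powr (- real (f (n + 1))))"
proof (rule ccontr)
  assume div: "\<not> ?thesis"
  obtain M where M: "is_oracle_tm M" and outputs: "\<And>n. 1 \<le> n \<Longrightarrow>
      otm_outputs M (set_restrict (dom V) (int n)) n (real_restrict \<alpha> (int n - int (f n)))"
    using assms(5) by blast
  have "computer V" using assms(3) by (simp add: optimal_computer_def)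
  then obtain r where r: "\<And>s. rec_eval r [str_code s] = map_option str_code (V s)"
    and pf: "prefix_free (dom V)"
    by (auto simp: computer_def partial_recursive_str_def)
  define A where "A n t = {s. length s \<le> n \<and> bounded_eval {..<t} r [str_code s] \<noteq> None}" for n t
  \<comment> \<open>One index serves as oracle stage and as step bound. This loses nothing:
    \<open>A n t\<close> is eventually the true oracle, and a result persists under longer
    runs.\<close>
  define out where "out n t = otm_result M (A n t) n t" for n t
  let ?D = "\<lambda>n. {s \<in> dom V. length s \<le> n}"
  have A_mono: "mono (A n)" for n
  proof (rule monoI)
    fix t t' :: nat
    assume "t \<le> t'"
    then have "{..<t} \<subseteq> {..<t'}" by auto
    from bounded_eval_mono[OF this] show "A n t \<subseteq> A n t'" by (auto simp: A_def)
  qed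
  have A_sub: "A n t \<subseteq> ?D n" for n t
  proof
    fix s
    assume "s \<in> A n t"
    then obtain y where "bounded_eval {..<t} r [str_code s] = Some y" "length s \<le> n" by (auto simp: A_def)
    then show "s \<in> ?D n" using bounded_eval_mono[OF subset_UNIV, of "{..<t}" r "[str_code s]" y]
      by (auto simp: bounded_eval_UNIV r)
  qed
  have A_lim: "\<forall>\<^sub>F t in sequentially. A n t = ?D n" for n
  proof -
    have "\<forall>\<^sub>F t in sequentially. \<forall>s\<in>?D n. s \<in> A n t"
    proof (intro eventually_ball_finite finite_short ballI)
      fix s
      assume s: "s \<in> ?D n"
      then obtain y where "rec_eval r [str_code s] = Some y" by (auto simp: r)
      from eventually_bounded_eval[OF this] show "\<forall>\<^sub>F t in sequentially. s \<in> A n t"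
        by eventually_elim (use s in \<open>auto simp: A_def\<close>)
    qed
    then show ?thesis by eventually_elim (use A_sub[of n] in blast)
  qed
  interpret approximation_test f out "dom V"
  proof
    show "computable (\<lambda>n. f (Suc n))"
    proof -
      obtain rf where "\<And>n. rec_eval rf [n] = (if 1 \<le> n then Some (f n) else None)"
        using assms(4) by (auto simp: total_recursive_pos_def partial_recursive_def)
      then have "\<forall>n. rec_eval (Comp rf [Succ]) [enc n] = Some (enc (f (Suc n)))" by simp
      then show ?thesis unfolding computable_def ..
    qed
    have "computable (\<lambda>w :: (nat \<times> nat) \<times> bool list. snd w \<in> A (fst (fst w)) (snd (fst w)))"
      unfolding A_def mem_Collect_eq by (intro computable_intros computable_bounded_eval)
    then show "computable (\<lambda>z. out (fst z) (snd z))"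
      unfolding out_def by (intro computable_otm_result[OF M] computable_intros)
    show "prefix_free (dom V)" by (rule pf)
    show "finite {s. \<exists>t. out n t = Some s}"
      "card {s. \<exists>t. out n t = Some s} \<le> card {p \<in> dom V. length p \<le> n} + 1" for n
      unfolding out_def using card_otm_results[OF A_mono finite_short A_sub] by blast+
  qed
  define a where "a = binary_expansion \<alpha>"
  have out: "\<exists>t. out n t = Some (map a [0..<n - f n])" if n: "1 \<le> n" "f n \<le> n" for n
  proof -
    have "otm_outputs M (?D n) n (map a [0..<n - f n])"
      using outputs[OF n(1)] n(2)
      by (simp add: set_restrict_def real_restrict_def a_def flip: of_nat_diff)
    then obtain t where t: "otm_result M (?D n) n t = Some (map a [0..<n - f n])"
      using otm_outputs_result by blast
    have "\<forall>\<^sub>F t' in sequentially. t \<le> t' \<and> A n t' = ?D n"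
      using A_lim by (intro eventually_conj eventually_ge_at_top)
    then obtain t' where "t \<le> t'" "A n t' = ?D n" by (auto dest: eventually_happens)
    then show ?thesis using otm_result_mono[OF t] unfolding out_def by metis
  qed
  obtain d where d: "\<And>p. p \<in> dom machine \<Longrightarrow>
      \<exists>q\<in>dom U. U q = machine p \<and> length q \<le> length p + d"
    using assms(1) computer_machine unfolding optimal_computer_def by blast
  obtain c where c: "\<And>n. 1 \<le> n \<Longrightarrow>
      int n - int c \<le> int (complexity U (real_restrict \<alpha> (int n)))"
    using assms(2) by (auto simp: weakly_Chaitin_random_def)
  \<comment> \<open>Of the gain \<open>c + d + 2\<close>, \<open>d\<close> pays for simulation by
    \<open>U\<close> and 1 for the \<open>+ 1\<close> in the length; what is left beats the
    randomness constant \<open>c\<close> by one bit.\<close>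
  from machine_compresses[OF out div, of "c + d + 2"] obtain n p where
    p: "n \<ge> 1" "machine p = Some (map a [0..<n])" "length p + (c + d + 2) = n + 1" by blast
  then obtain q where q: "U q = Some (map a [0..<n])" "length q \<le> length p + d"
    using d[of p] by (metis domI)
  have "complexity U (map a [0..<n]) \<le> length q"
    unfolding complexity_def by (rule cInf_lower) (use q(1) in auto)
  moreover have "real_restrict \<alpha> (int n) = map a [0..<n]" by (simp add: real_restrict_def a_def)
  ultimately show False using c[OF p(1)] p(3) q(2) by simp
qed

end
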